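(* Let $\mathbf b$ be an ideal of $O_K$ whose class $Cl(\mathbf b)\in C_p^+$ has order $p$ and is annihilated by $\sigma-\mu$, where $\mu=u_{2m}$, $1\le m\le\frac{p-3}{2}$. Let $B\in O_K$ be a singular semi-primary integer with $BO_K=\mathbf b^p$ and $\sigma(B)=B^{\mu}\alpha^p$ for some $\alpha\in K$. If $m>\frac{p-1}{4}$, then there is $\delta\in\mathbb{Z}$ such that $$B^{p-1}\equiv 1-\delta\,\bigl(\zeta+\mu^{-1}\zeta^{u}+\dots+\mu^{-(p-2)}\zeta^{u_{p-2}}\bigr)\bmod \pi^{p-1},$$ where the sum is $\sum_{i=0}^{p-2}\mu^{-i}\zeta^{u_i}$, and $\delta$ is coprime with $p$ when $B$ is non-primary.
   Context: Let $p$ be an odd prime, $\zeta$ a primitive $p$-th root of unity, $K=\mathbb{Q}(\zeta)$, $O_K=\mathbb{Z}[\zeta]$, $\pi=(1-\zeta)O_K$ the prime ideal over $p$. Congruences modulo powers of $\pi$ are between $\pi$-integral elements of $K$ (so $\mu^{-i}$ may be read as any integer inverse of $\mu^i$ modulo $p$, since $pO_K=\pi^{p-1}$). Let $u$ be a primitive root mod $p$ and $\sigma$ the generator of $\mathrm{Gal}(K/\mathbb{Q})$ with $\sigma(\zeta)=\zeta^u$; $u_i$ denotes the integer with $u_i\equiv u^i \bmod p$, $1\le u_i\le p-1$. A class $c$ is annihilated by $\sigma-\mu$ if $\sigma(c)=c^\mu$. $C_p$ is the subgroup of the class group of $K$ killed by $p$, and $C_p^+$ its plus part (classes $c\in C_p$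 fixed by complex conjugation), which is identified with the corresponding subgroup of the class group of $K^+=\mathbb{Q}(\zeta+\zeta^{-1})$. A number $C\in K$ is singular if it is not a $p$-th power in $K$ and $CO_K=\mathbf c^p$ for some (fractional) ideal $\mathbf c$ of $K$; a singular integer is a singular number in $O_K$. A singular number $C$ is primary if $C\equiv c^p \bmod \pi^p$ for some $c\in\mathbb{Z}$ with $c\not\equiv0\bmod p$, and semi-primary if $C\equiv c\bmod\pi^2$ for some $c\in\mathbb{Z}$ with $c\not\equiv 0\bmod p$. *)

theory Defs
  imports Complex_Main "HOL-Algebra.Algebra" "HOL-Number_Theory.Number_Theory"
begin

section \<open>Fractional ideals and the ideal class group\<close>

text \<open>
  Here \<open>K\<close> is a field and \<open>R\<close> is a subring of \<open>K\<close> (with the same operations) whose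
  field of fractions is \<open>K\<close>.
\<close>

definition fractional_ideal :: "('a, 'b) ring_scheme \<Rightarrow> ('a, 'c) ring_scheme \<Rightarrow> 'a set \<Rightarrow> bool" where
  "fractional_ideal R K I \<longleftrightarrow>
     subgroup I (add_monoid K) \<and>
     (\<forall>r\<in>carrier R. \<forall>x\<in>I. r \<otimes>\<^bsub>K\<^esub> x \<in> I) \<and>
     (\<exists>d\<in>carrier R - {\<zero>\<^bsub>K\<^esub>}. \<forall>x\<in>I. d \<otimes>\<^bsub>K\<^esub> x \<in> carrier R)"

definition frac_ideal_group :: "('a, 'b) ring_scheme \<Rightarrow> ('a, 'c) ring_scheme \<Rightarrow> 'a set monoid" where
  "frac_ideal_group R K =
     \<lparr> carrier = {I. fractional_ideal R K I \<and> I \<noteq> {\<zero>\<^bsub>K\<^esub>}},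
       monoid.mult = ideal_prod K,
       monoid.one = carrier R \<rparr>"

definition principal_frac_ideals :: "('a, 'b) ring_scheme \<Rightarrow> ('a, 'c) ring_scheme \<Rightarrow> 'a set set" where
  "principal_frac_ideals R K = {a <#\<^bsub>K\<^esub> carrier R | a. a \<in> carrier K - {\<zero>\<^bsub>K\<^esub>}}"

definition class_group :: "('a, 'b) ring_scheme \<Rightarrow> ('a, 'c) ring_scheme \<Rightarrow> 'a set set monoid" where
  "class_group R K = frac_ideal_group R K Mod principal_frac_ideals R K"

definition ideal_class :: "('a, 'b) ring_scheme \<Rightarrow> ('a, 'c) ring_scheme \<Rightarrow> 'a set \<Rightarrow> 'a set set" where
  "ideal_class R K I = principal_frac_ideals R K #>\<^bsub>frac_ideal_group R K\<^esub> I"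

text \<open>
  An ideal class is a coset, i.e. a set of fractional ideals. An automorphism acts on it by
  taking the image of every ideal in it.
\<close>
definition class_action :: "('a \<Rightarrow> 'a) \<Rightarrow> 'a set set \<Rightarrow> 'a set set" where
  "class_action \<sigma> c = (\<lambda>I. \<sigma> ` I) ` c"


section \<open>The cyclotomic field and its ring of integers\<close>

definition primitive_root_of_unity :: "nat \<Rightarrow> complex \<Rightarrow> bool" where
  "primitive_root_of_unity n z \<longleftrightarrow> n > 0 \<and> z ^ n = 1 \<and> (\<forall>k. 0 < k \<and> k < n \<longrightarrow> z ^ k \<noteq> 1)"

definition complex_ring :: "complex ring" where
  "complex_ring = \<lparr> carrier = UNIV, monoid.mult = (*), monoid.one = 1, ring.zero = 0, ring.add = (+) \<rparr>"

definition cyc_field :: "complex \<Rightarrow> complex ring" where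
  "cyc_field \<zeta> = complex_ring \<lparr> carrier := generate_field complex_ring {\<zeta>} \<rparr>"

definition cyc_ints :: "complex \<Rightarrow> complex ring" where
  "cyc_ints \<zeta> = complex_ring \<lparr> carrier := generate_ring complex_ring {\<zeta>} \<rparr>"

text \<open>
  The group of automorphisms of \<open>K\<close> over the rationals. Its elements are functions on all of the
  complex numbers, whose values outside \<open>K\<close> are irrelevant.
\<close>
definition Gal_rat :: "complex ring \<Rightarrow> (complex \<Rightarrow> complex) set" where
  "Gal_rat K = {\<sigma> \<in> ring_iso K K. \<forall>q\<in>\<rat>. \<sigma> q = q}"

definition cyc_class_group :: "complex \<Rightarrow> complex set set monoid" where
  "cyc_class_group \<zeta> = class_group (cyc_ints \<zeta>) (cyc_field \<zeta>)"

definition cyc_class :: "complex \<Rightarrow> complex set \<Rightarrow> complex set set" where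
  "cyc_class \<zeta> I = ideal_class (cyc_ints \<zeta>) (cyc_field \<zeta>) I"

definition class_group_p :: "nat \<Rightarrow> complex \<Rightarrow> complex set set set" where
  "class_group_p p \<zeta> =
     {c \<in> carrier (cyc_class_group \<zeta>). c [^]\<^bsub>cyc_class_group \<zeta>\<^esub> p = \<one>\<^bsub>cyc_class_group \<zeta>\<^esub>}"

definition class_group_p_plus :: "nat \<Rightarrow> complex \<Rightarrow> complex set set set" where
  "class_group_p_plus p \<zeta> = {c \<in> class_group_p p \<zeta>. class_action cnj c = c}"

definition annihilated_by :: "complex \<Rightarrow> (complex \<Rightarrow> complex) \<Rightarrow> nat \<Rightarrow> complex set set \<Rightarrow> bool" where
  "annihilated_by \<zeta> \<sigma> \<mu> c \<longleftrightarrow> class_action \<sigma> c = c [^]\<^bsub>cyc_class_group \<zeta>\<^esub> \<mu>"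


section \<open>Congruences modulo powers of the prime above \<open>p\<close>\<close>

definition prime_pi :: "complex \<Rightarrow> complex set" where
  "prime_pi \<zeta> = (1 - \<zeta>) <#\<^bsub>cyc_ints \<zeta>\<^esub> carrier (cyc_ints \<zeta>)"

definition prime_pi_pow :: "complex \<Rightarrow> nat \<Rightarrow> complex set" where
  "prime_pi_pow \<zeta> k = prime_pi \<zeta> [^]\<^bsub>ideals_set (cyc_ints \<zeta>)\<^esub> k"

text \<open>
  The extension of the \<open>k\<close>-th power of the prime to the local ring of the \<open>\<pi>\<close>-integral elements
  of the field; \<open>k = 0\<close> gives this local ring itself.
\<close>
definition pi_local :: "complex \<Rightarrow> nat \<Rightarrow> complex set" where
  "pi_local \<zeta> k = {a / b | a b. a \<in> prime_pi_pow \<zeta> k \<and> b \<in> carrier (cyc_ints \<zeta>) - prime_pi \<zeta>}"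

definition pi_cong :: "complex \<Rightarrow> nat \<Rightarrow> complex \<Rightarrow> complex \<Rightarrow> bool" where
  "pi_cong \<zeta> k x y \<longleftrightarrow> x \<in> pi_local \<zeta> 0 \<and> y \<in> pi_local \<zeta> 0 \<and> x - y \<in> pi_local \<zeta> k"


section \<open>Singular, primary and semi-primary numbers\<close>

definition singular_number :: "nat \<Rightarrow> complex \<Rightarrow> complex \<Rightarrow> bool" where
  "singular_number p \<zeta> C \<longleftrightarrow>
     C \<in> carrier (cyc_field \<zeta>) \<and>
     \<not> (\<exists>x\<in>carrier (cyc_field \<zeta>). C = x ^ p) \<and>
     (\<exists>\<cc>\<in>carrier (frac_ideal_group (cyc_ints \<zeta>) (cyc_field \<zeta>)).
        C <#\<^bsub>cyc_field \<zeta>\<^esub> carrier (cyc_ints \<zeta>) =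
        \<cc> [^]\<^bsub>frac_ideal_group (cyc_ints \<zeta>) (cyc_field \<zeta>)\<^esub> p)"

definition singular_integer :: "nat \<Rightarrow> complex \<Rightarrow> complex \<Rightarrow> bool" where
  "singular_integer p \<zeta> C \<longleftrightarrow> singular_number p \<zeta> C \<and> C \<in> carrier (cyc_ints \<zeta>)"

definition primary :: "nat \<Rightarrow> complex \<Rightarrow> complex \<Rightarrow> bool" where
  "primary p \<zeta> C \<longleftrightarrow>
     singular_number p \<zeta> C \<and>
     (\<exists>c::int. \<not> [c = 0] (mod int p) \<and> pi_cong \<zeta> p C (of_int c ^ p))"

definition semi_primary :: "nat \<Rightarrow> complex \<Rightarrow> complex \<Rightarrow> bool" where
  "semi_primary p \<zeta> C \<longleftrightarrow>
     singular_number p \<zeta> C \<and>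
     (\<exists>c::int. \<not> [c = 0] (mod int p) \<and> pi_cong \<zeta> 2 C (of_int c))"

end

theory Submission
  imports Defs "Jordan_Normal_Form.Char_Poly"
begin

text \<open>
  Put \<open>\<lambda> = 1 - \<zeta>\<close> and \<open>A = B\<^sup>p\<^sup>-\<^sup>1\<close>. Since \<open>p\<close>-th powers of \<open>\<pi>\<close>-units raised to the power \<open>p - 1\<close> are
  \<open>1\<close> modulo \<open>\<pi>\<^sup>p\<close>, the relation \<open>\<sigma>(B) = B\<^sup>\<mu>\<alpha>\<^sup>p\<close> gives \<open>\<sigma>(A) \<equiv> A\<^sup>\<mu>\<close> modulo \<open>\<pi>\<^sup>p\<close>. On
  \<open>\<pi>\<^sup>k/\<pi>\<^sup>k\<^sup>+\<^sup>1\<close> the automorphism \<open>\<sigma>\<close> acts as multiplication by \<open>u\<^sup>k\<close>, so if \<open>A - 1\<close> has \<open>\<pi>\<close>-order \<open>k < p\<close>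
  then \<open>u\<^sup>k \<equiv> \<mu> = u\<^sup>2\<^sup>m\<close>, that is, \<open>k = 2m\<close>. As \<open>4m \<ge> p\<close>, the power
  \<open>A\<^sup>\<mu>\<close> may be linearised: \<open>D = A - 1\<close> satisfies \<open>\<sigma>(D) \<equiv> \<mu>D\<close> modulo \<open>\<pi>\<^sup>p\<^sup>-\<^sup>1\<close>. Averaging
  \<open>\<mu>\<^sup>-\<^sup>i\<sigma>\<^sup>i(D)\<close> over \<open>i\<close> projects \<open>D\<close>, and every \<open>\<zeta>\<^sup>k\<close>, onto integer multiples of the given sum. If
  \<open>p\<close> divides \<open>\<delta>\<close>, then \<open>A \<equiv> 1\<close> modulo \<open>\<pi>\<^sup>p\<^sup>-\<^sup>1\<close>, hence modulo \<open>\<pi>\<^sup>p\<close> because \<open>2m \<noteq> p - 1\<close>, and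
  \<open>B \<equiv> BA = B\<^sup>p \<equiv> c\<^sup>p\<close> is primary.
\<close>

section \<open>The cyclotomic ring\<close>

text \<open>The characteristic polynomial of \<open>M\<close> is monic with integer coefficients and
  has \<open>x\<close> as a root. The intended matrix is multiplication by \<open>x\<close> on the
  powers of \<zeta>.\<close>

lemma eigenvalue_int_matrix_algebraic_int:
  fixes x :: complex and M :: "nat \<Rightarrow> nat \<Rightarrow> int" and v :: "nat \<Rightarrow> complex"
  assumes ev: "\<And>i. i < n \<Longrightarrow> x * v i = (\<Sum>j<n. of_int (M i j) * v j)"
    and nz: "k < n" "v k \<noteq> 0"
  shows "algebraic_int x"
proof -
  define A where "A = mat n n (\<lambda>(i, j). M i j)"
  have A: "A \<in> carrier_mat n n" by (simp add: A_def)
  let ?A = "map_mat complex_of_int A"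
  have A': "?A \<in> carrier_mat n n" using A by simp
  have "eigenvector ?A (vec n v) x"
    unfolding eigenvector_def
  proof (intro conjI)
    show "vec n v \<in> carrier_vec (dim_row ?A)" using A by simp
    show "vec n v \<noteq> 0\<^sub>v (dim_row ?A)"
      using nz A by (metis carrier_matD(1) index_map_mat(2) index_vec index_zero_vec(1))
    show "?A *\<^sub>v vec n v = x \<cdot>\<^sub>v vec n v"
      using A ev by (auto simp: A_def scalar_prod_def atLeast0LessThan intro!: eq_vecI)
  qed
  hence "poly (char_poly ?A) x = 0"
    using eigenvalue_root_char_poly[OF A'] by (auto simp: eigenvalue_def)
  hence "poly (map_poly of_int (char_poly A)) x = 0"
    using of_int_hom.char_poly_hom[OF A] by metis
  moreover have "lead_coeff (char_poly A) = 1"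
    using degree_monic_char_poly[OF A] by simp
  ultimately show ?thesis by (auto simp: algebraic_int_altdef_ipoly)
qed

section \<open>The complex numbers as an algebraic ring, and closure properties of
  \<open>cyc_ints\<close> and \<open>cyc_field\<close>\<close>

lemma field_complex_ring: "field complex_ring"
proof -
  have "\<exists>y. y + x = 0 \<and> x + y = 0" for x :: complex
    by (intro exI[of _ "- x"]) simp
  moreover have "\<exists>y. y * x = 1 \<and> x * y = 1" if "x \<noteq> 0" for x :: complex
    using that by (intro exI[of _ "inverse x"]) simp
  ultimately show ?thesis
    by unfold_locales (auto simp: complex_ring_def Units_def algebra_simps)
qed

lemma a_inv_complex_ring: "\<ominus>\<^bsub>complex_ring\<^esub> x = - x"
proof -
  interpret field complex_ring by (rule field_complex_ring)
  show ?thesis by (rule minus_equality) (simp_all add: complex_ring_def)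
qed

lemma m_inv_complex_ring: "x \<noteq> 0 \<Longrightarrow> inv\<^bsub>complex_ring\<^esub> x = inverse x"
proof -
  interpret field complex_ring by (rule field_complex_ring)
  show "x \<noteq> 0 \<Longrightarrow> inv\<^bsub>complex_ring\<^esub> x = inverse x" by (rule comm_inv_char) (simp_all add: complex_ring_def)
qed

lemma cyc_ints_simps [simp]:
  "monoid.mult (cyc_ints \<zeta>) = (*)" "ring.add (cyc_ints \<zeta>) = (+)"
  by (simp_all add: cyc_ints_def complex_ring_def)

lemma cyc_field_simps [simp]:
  "monoid.mult (cyc_field \<zeta>) = (*)" "ring.add (cyc_field \<zeta>) = (+)" "one (cyc_field \<zeta>) = 1"
  by (simp_all add: cyc_field_def complex_ring_def)

lemma carrier_cyc_ints: "carrier (cyc_ints \<zeta>) = generate_ring complex_ring {\<zeta>}"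
  by (simp add: cyc_ints_def)

lemma carrier_cyc_field: "carrier (cyc_field \<zeta>) = generate_field complex_ring {\<zeta>}"
  by (simp add: cyc_field_def)

lemma cyc_ints_one [intro, simp]: "1 \<in> carrier (cyc_ints \<zeta>)"
  using generate_ring.one[of complex_ring "{\<zeta>}"] by (simp add: carrier_cyc_ints complex_ring_def)

lemma cyc_ints_gen [intro, simp]: "\<zeta> \<in> carrier (cyc_ints \<zeta>)"
  using generate_ring.incl[of \<zeta> "{\<zeta>}" complex_ring] by (simp add: carrier_cyc_ints)

lemma cyc_ints_uminus [intro, simp]:
  "x \<in> carrier (cyc_ints \<zeta>) \<Longrightarrow> - x \<in> carrier (cyc_ints \<zeta>)"
  using generate_ring.a_inv[of x complex_ring "{\<zeta>}"] by (simp add: carrier_cyc_ints a_inv_complex_ring)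

lemma cyc_ints_add [intro, simp]:
  "x \<in> carrier (cyc_ints \<zeta>) \<Longrightarrow> y \<in> carrier (cyc_ints \<zeta>) \<Longrightarrow> x + y \<in> carrier (cyc_ints \<zeta>)"
  using generate_ring.eng_add[of x complex_ring "{\<zeta>}" y] by (simp add: carrier_cyc_ints complex_ring_def)

lemma cyc_ints_mult [intro, simp]:
  "x \<in> carrier (cyc_ints \<zeta>) \<Longrightarrow> y \<in> carrier (cyc_ints \<zeta>) \<Longrightarrow> x * y \<in> carrier (cyc_ints \<zeta>)"
  using generate_ring.eng_mult[of x complex_ring "{\<zeta>}" y] by (simp add: carrier_cyc_ints complex_ring_def)

lemma cyc_ints_diff [intro, simp]:
  "x \<in> carrier (cyc_ints \<zeta>) \<Longrightarrow> y \<in> carrier (cyc_ints \<zeta>) \<Longrightarrow> x - y \<in> carrier (cyc_ints \<zeta>)"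
  using cyc_ints_add[of x \<zeta> "- y"] by simp

lemma cyc_ints_zero [intro, simp]: "0 \<in> carrier (cyc_ints \<zeta>)"
  using cyc_ints_diff[of 1 \<zeta> 1] by simp

lemma cyc_ints_power [intro, simp]: "x \<in> carrier (cyc_ints \<zeta>) \<Longrightarrow> x ^ n \<in> carrier (cyc_ints \<zeta>)"
  by (induction n) auto

lemma cyc_ints_of_nat [intro, simp]: "of_nat n \<in> carrier (cyc_ints \<zeta>)"
  by (induction n) auto

lemma cyc_ints_of_int [intro, simp]: "of_int n \<in> carrier (cyc_ints \<zeta>)"
  by (cases n) auto

lemma cyc_ints_sum [intro, simp]:
  "(\<And>i. i \<in> A \<Longrightarrow> f i \<in> carrier (cyc_ints \<zeta>)) \<Longrightarrow> sum f A \<in> carrier (cyc_ints \<zeta>)"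
  by (induction A rule: infinite_finite_induct) auto

lemma cyc_ints_poly:
  "x \<in> carrier (cyc_ints \<zeta>) \<Longrightarrow> poly (map_poly of_int f) x \<in> carrier (cyc_ints \<zeta>)"
  by (induction f) (auto simp: map_poly_pCons)

lemma cyc_ints_subset_cyc_field: "carrier (cyc_ints \<zeta>) \<subseteq> carrier (cyc_field \<zeta>)"
proof
  fix x assume "x \<in> carrier (cyc_ints \<zeta>)"
  thus "x \<in> carrier (cyc_field \<zeta>)"
    unfolding carrier_cyc_ints carrier_cyc_field
    by (induction rule: generate_ring.induct) (auto intro: generate_field.intros)
qed

lemma cyc_field_as_fraction:
  assumes "x \<in> carrier (cyc_field \<zeta>)"
  obtains a b where "a \<in> carrier (cyc_ints \<zeta>)" "b \<in> carrier (cyc_ints \<zeta>)" "b \<noteq> 0" "x = a / b"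
proof -
  from assms have "\<exists>a b. a \<in> carrier (cyc_ints \<zeta>) \<and> b \<in> carrier (cyc_ints \<zeta>) \<and> b \<noteq> 0 \<and> x = a / b"
    unfolding carrier_cyc_field
  proof (induction rule: generate_field.induct)
    case one
    show ?case by (intro exI[of _ 1]) (auto simp: complex_ring_def)
  next
    case (incl h)
    thus ?case by (intro exI[of _ h] exI[of _ 1]) auto
  next
    case (a_inv h)
    then obtain a b where "a \<in> carrier (cyc_ints \<zeta>)" "b \<in> carrier (cyc_ints \<zeta>)" "b \<noteq> 0" "h = a / b" by blast
    thus ?case by (intro exI[of _ "-a"] exI[of _ b]) (auto simp: a_inv_complex_ring)
  next
    case (m_inv h)
    then obtain a b where "a \<in> carrier (cyc_ints \<zeta>)" "b \<in> carrier (cyc_ints \<zeta>)" "b \<noteq> 0" "h = a / b" by blast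
    moreover from m_inv have "h \<noteq> 0" by (simp add: complex_ring_def)
    ultimately show ?case by (intro exI[of _ b] exI[of _ a]) (auto simp: m_inv_complex_ring)
  next
    case (eng_add h1 h2)
    then obtain a b c d where "a \<in> carrier (cyc_ints \<zeta>)" "b \<in> carrier (cyc_ints \<zeta>)" "b \<noteq> 0" "h1 = a / b"
      "c \<in> carrier (cyc_ints \<zeta>)" "d \<in> carrier (cyc_ints \<zeta>)" "d \<noteq> 0" "h2 = c / d" by blast
    thus ?case by (intro exI[of _ "a * d + c * b"] exI[of _ "b * d"])
       (auto simp: complex_ring_def add_frac_eq)
  next
    case (eng_mult h1 h2)
    then obtain a b c d where "a \<in> carrier (cyc_ints \<zeta>)" "b \<in> carrier (cyc_ints \<zeta>)" "b \<noteq> 0" "h1 = a / b"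
      "c \<in> carrier (cyc_ints \<zeta>)" "d \<in> carrier (cyc_ints \<zeta>)" "d \<noteq> 0" "h2 = c / d" by blast
    thus ?case by (intro exI[of _ "a * c"] exI[of _ "b * d"]) (auto simp: complex_ring_def)
  qed
  thus ?thesis using that by blast
qed

text \<open>Splitting off the constant coefficient \<open>a\<close> writes \<open>a\<close> as a
  multiple of \<open>x\<close>; if \<open>a\<close> vanishes, a factor \<open>x\<close> cancels and
  the degree drops.\<close>

lemma int_poly_root_dvd_int:
  assumes "poly (map_poly of_int f) x = 0" "f \<noteq> 0" "x \<noteq> 0" "x \<in> carrier (cyc_ints \<zeta>)"
  shows "\<exists>y\<in>carrier (cyc_ints \<zeta>). \<exists>n. n \<noteq> 0 \<and> x * y = of_int n"
  using assms
proof (induction f)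
  case 0
  thus ?case by simp
next
  case (pCons a f)
  show ?case
  proof (cases "a = 0")
    case True
    with pCons show ?thesis by (auto simp: map_poly_pCons)
  next
    case False
    have "x * (- poly (map_poly of_int f) x) = of_int a"
      using pCons.prems(1) pCons.hyps by (simp add: map_poly_pCons neg_eq_iff_add_eq_0 add.commute)
    with False cyc_ints_poly[OF pCons.prems(4)] show ?thesis
      by (intro bexI[of _ "- poly (map_poly of_int f) x"] exI[of _ a]) auto
  qed
qed

section \<open>Coordinates and integrality in \<open>OK\<close>, and the factorisation of
  \<open>p\<close> by \<open>lam\<close>\<close>

locale prime_cyclotomic =
  fixes p :: nat and \<zeta> :: complex
  assumes prime_p: "Factorial_Ring.prime p"
    and odd_p: "odd p"
    and primitive: "primitive_root_of_unity p \<zeta>"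
begin

abbreviation OK :: "complex set" where
  "OK \<equiv> carrier (cyc_ints \<zeta>)"

definition lam :: complex where
  "lam = 1 - \<zeta>"

text \<open>Divisibility by \<open>lam ^ k\<close> in \<open>OK\<close> replaces ideal powers and
  localisation; \<open>pi_cong_OK_iff\<close> shows that on \<open>OK\<close> this is
  \<open>pi_cong\<close>. Only the difference of \<open>x\<close> and \<open>y\<close> is
  constrained, not each of them.\<close>

definition cong_lam :: "nat \<Rightarrow> complex \<Rightarrow> complex \<Rightarrow> bool" where
  "cong_lam k x y \<longleftrightarrow> (\<exists>z\<in>OK. x - y = lam ^ k * z)"

lemma p_ge_3: "p \<ge> 3"
  using prime_ge_2_nat[OF prime_p] odd_p by (cases "p = 2") auto

lemma zeta_pow_p: "\<zeta> ^ p = 1"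
  using primitive by (simp add: primitive_root_of_unity_def)

lemma zeta_neq_1: "\<zeta> \<noteq> 1"
  using primitive p_ge_3 by (auto simp: primitive_root_of_unity_def dest: spec[of _ 1])

lemma zeta_pow_mod: "\<zeta> ^ (n mod p) = \<zeta> ^ n"
proof -
  have "\<zeta> ^ n = \<zeta> ^ (p * (n div p) + n mod p)" by simp
  also have "\<dots> = \<zeta> ^ (n mod p)" unfolding power_add power_mult by (simp add: zeta_pow_p)
  finally show ?thesis by simp
qed

lemma lam_neq_0: "lam \<noteq> 0"
  using zeta_neq_1 by (simp add: lam_def)

lemma lam_in_OK [intro, simp]: "lam \<in> OK"
  by (simp add: lam_def)

text \<open>All \<open>p\<close> powers of \<zeta> are allowed, at the cost of uniqueness: products
  then reduce by \<open>\<zeta> ^ p = 1\<close> alone, without the cyclotomic polynomial.\<close>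

lemma OK_as_sum:
  assumes "x \<in> OK"
  shows "\<exists>c::nat \<Rightarrow> int. x = (\<Sum>k<p. of_int (c k) * \<zeta> ^ k)"
proof -
  have delta: "(\<Sum>k<p. of_int (if k = j then a else 0) * \<zeta> ^ k) = of_int a * \<zeta> ^ j" if "j < p" for a j
  proof -
    have "(\<Sum>k<p. of_int (if k = j then a else 0) * \<zeta> ^ k) = (\<Sum>k<p. if k = j then of_int a * \<zeta> ^ k else 0)"
      by (intro sum.cong) auto
    thus ?thesis using that by simp
  qed
  from assms show ?thesis
    unfolding carrier_cyc_ints
  proof (induction rule: generate_ring.induct)
    case one
    show ?case using delta[of 0 1] p_ge_3 by (auto simp: complex_ring_def intro!: exI[of _ "\<lambda>k. if k = 0 then 1 else 0"])
  next
    case (incl h)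
    thus ?case using delta[of 1 1] p_ge_3 by (auto intro!: exI[of _ "\<lambda>k. if k = 1 then 1 else 0"])
  next
    case (a_inv h)
    then obtain c where "h = (\<Sum>k<p. of_int (c k) * \<zeta> ^ k)" by blast
    thus ?case by (intro exI[of _ "\<lambda>k. - c k"]) (simp add: a_inv_complex_ring sum_negf)
  next
    case (eng_add h1 h2)
    then obtain c d where "h1 = (\<Sum>k<p. of_int (c k) * \<zeta> ^ k)" "h2 = (\<Sum>k<p. of_int (d k) * \<zeta> ^ k)" by blast
    thus ?case by (intro exI[of _ "\<lambda>k. c k + d k"]) (simp add: complex_ring_def sum.distrib algebra_simps)
  next
    case (eng_mult h1 h2)
    then obtain c d where cd: "h1 = (\<Sum>k<p. of_int (c k) * \<zeta> ^ k)" "h2 = (\<Sum>k<p. of_int (d k) * \<zeta> ^ k)" by blast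
    \<comment> \<open>Cyclic convolution: exponents add modulo \<open>p\<close>.\<close>
    define e where "e j = (\<Sum>k<p. \<Sum>l<p. if j = (k + l) mod p then c k * d l else 0)" for j
    have "h1 * h2 = (\<Sum>k<p. \<Sum>l<p. of_int (c k * d l) * \<zeta> ^ (k + l))"
      unfolding cd by (simp add: sum_product power_add algebra_simps)
    also have "\<dots> = (\<Sum>k<p. \<Sum>l<p. \<Sum>j<p. of_int (if j = (k + l) mod p then c k * d l else 0) * \<zeta> ^ j)"
    proof (rule sum.cong[OF refl], rule sum.cong[OF refl])
      fix k l
      have "(k + l) mod p < p" using p_ge_3 by simp
      from delta[OF this] show "of_int (c k * d l) * \<zeta> ^ (k + l) =
          (\<Sum>j<p. of_int (if j = (k + l) mod p then c k * d l else 0) * \<zeta> ^ j)"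
        by (simp only: zeta_pow_mod)
    qed
    also have "\<dots> = (\<Sum>k<p. \<Sum>j<p. \<Sum>l<p. of_int (if j = (k + l) mod p then c k * d l else 0) * \<zeta> ^ j)"
      by (rule sum.cong[OF refl sum.swap])
    also have "\<dots> = (\<Sum>j<p. \<Sum>k<p. \<Sum>l<p. of_int (if j = (k + l) mod p then c k * d l else 0) * \<zeta> ^ j)"
      by (rule sum.swap)
    also have "\<dots> = (\<Sum>j<p. of_int (e j) * \<zeta> ^ j)"
      by (simp add: e_def sum_distrib_right)
    finally show ?case by (auto simp: complex_ring_def)
  qed
qed

text \<open>Multiplication by \<open>x\<close> acts on the powers of \<zeta> through an integer
  matrix, with eigenvector \<open>\<lambda>i. \<zeta> ^ i\<close>, whose entry at 0 is 1.\<close>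

lemma OK_algebraic_int:
  assumes "x \<in> OK"
  shows "algebraic_int x"
proof -
  have "\<exists>M::nat \<Rightarrow> int. x * \<zeta> ^ i = (\<Sum>j<p. of_int (M j) * \<zeta> ^ j)" for i
    using assms by (intro OK_as_sum) auto
  then obtain M :: "nat \<Rightarrow> nat \<Rightarrow> int" where "\<And>i. x * \<zeta> ^ i = (\<Sum>j<p. of_int (M i j) * \<zeta> ^ j)"
    by metis
  thus ?thesis
    using p_ge_3 by (intro eigenvalue_int_matrix_algebraic_int[of p x "\<lambda>i. \<zeta> ^ i" M 0]) auto
qed

text \<open>The quotient \<open>a / b\<close> is rational and an algebraic integer, hence an
  integer. This brings divisibility in \<open>OK\<close> down to the integers.\<close>

lemma OK_int_dvd:
  assumes "x \<in> OK" "of_int a = of_int b * x" "b \<noteq> 0"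
  shows "b dvd a"
proof -
  have "x = of_int a / of_int b" using assms(2,3) by (simp add: field_simps)
  hence "x \<in> \<rat>" by simp
  with OK_algebraic_int[OF assms(1)] obtain n where "x = of_int n"
    using rational_algebraic_int_is_int by (auto elim: Ints_cases)
  with assms(2) have "of_int a = (of_int (b * n) :: complex)" by simp
  hence "a = b * n" by (simp only: of_int_eq_iff)
  thus ?thesis by simp
qed

lemma OK_dvd_int:
  assumes "x \<in> OK" "x \<noteq> 0"
  obtains y n where "y \<in> OK" "n \<noteq> 0" "x * y = of_int n"
proof -
  obtain f where f: "poly (map_poly of_int f) x = 0" "lead_coeff f = 1"
    using OK_algebraic_int[OF assms(1)] unfolding algebraic_int_altdef_ipoly by blast
  hence "f \<noteq> 0" by auto
  from int_poly_root_dvd_int[OF f(1) this assms(2,1)] show ?thesis using that by blast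
qed

text \<open>In the expansion of \<open>1 = \<zeta> ^ p = (1 - lam) ^ p\<close> every middle
  coefficient is divisible by \<open>p\<close>; collecting these terms and cancelling one
  \<open>lam\<close> gives the identity. Since \<open>1 - lam * s\<close> is 1 modulo
  \<open>lam\<close>, \<open>p\<close> and \<open>lam ^ (p - 1)\<close> agree up to a
  \<pi>-unit.\<close>

lemma p_times_unit:
  obtains s where "s \<in> OK" "of_nat p * (1 - lam * s) = - (lam ^ (p - 1))"
proof -
  define c where "c k = (p choose k) div p" for k
  define s where "s = (\<Sum>k=2..<p. of_nat (c k) * (- 1) ^ k * lam ^ (k - 2))"
  have c: "of_nat (p choose k) = of_nat p * (of_nat (c k) :: complex)" if "k \<in> {2..<p}" for k
    using dvd_choose_prime[of k p] that prime_p by (simp add: c_def flip: of_nat_mult)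
  have "1 = (- lam + 1) ^ p"
    by (simp add: lam_def zeta_pow_p)
  also have "\<dots> = (\<Sum>k\<le>p. of_nat (p choose k) * (- lam) ^ k)"
    unfolding binomial_ring by simp
  also have "{..p} = insert 0 (insert 1 (insert p {2..<p}))"
    using p_ge_3 by auto
  also have "(\<Sum>k\<in>insert 0 (insert 1 (insert p {2..<p})). of_nat (p choose k) * (- lam) ^ k)
      = 1 - of_nat p * lam + (- lam) ^ p + (\<Sum>k=2..<p. of_nat (p choose k) * (- lam) ^ k)"
    using p_ge_3 by (simp add: algebra_simps)
  also have "(\<Sum>k=2..<p. of_nat (p choose k) * (- lam) ^ k) = of_nat p * lam ^ 2 * s"
    unfolding s_def sum_distrib_left
  proof (intro sum.cong refl)
    fix k assume k: "k \<in> {2..<p}"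
    have "lam ^ k = lam ^ 2 * lam ^ (k - 2)"
      using k by (metis atLeastLessThan_iff le_add_diff_inverse power_add)
    hence "(- lam) ^ k = (- 1) ^ k * (lam ^ 2 * lam ^ (k - 2))"
      using power_minus[of lam k] by simp
    thus "of_nat (p choose k) * (- lam) ^ k = of_nat p * lam ^ 2 * (of_nat (c k) * (- 1) ^ k * lam ^ (k - 2))"
      by (simp add: c[OF k])
  qed
  also have "(- lam) ^ p = - (lam * lam ^ (p - 1))"
    using p_ge_3 odd_p by (simp flip: power_Suc)
  finally have "lam * (of_nat p * (1 - lam * s)) = lam * (- (lam ^ (p - 1)))"
    by (simp add: algebra_simps power2_eq_square)
  hence "of_nat p * (1 - lam * s) = - (lam ^ (p - 1))"
    by (rule mult_left_cancel[OF lam_neq_0, THEN iffD1])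
  moreover have "s \<in> OK" unfolding s_def by auto
  ultimately show ?thesis using that by blast
qed

text \<open>Rewritten as \<open>p = p * lam * s - lam ^ (p - 1)\<close>, the previous identity gains
  one factor \<open>lam\<close> per induction step, which avoids inverting
  \<open>1 - lam * s\<close>.\<close>

lemma lam_pow_dvd_p: "k \<le> p - 1 \<Longrightarrow> \<exists>w\<in>OK. of_nat p = lam ^ k * w"
proof (induction k)
  case 0
  show ?case by (intro bexI[of _ "of_nat p"]) auto
next
  case (Suc k)
  then obtain w where w: "w \<in> OK" "of_nat p = lam ^ k * w" by auto
  obtain s where s: "s \<in> OK" "of_nat p * (1 - lam * s) = - (lam ^ (p - 1))" by (rule p_times_unit)
  have "of_nat p = of_nat p * lam * s - lam ^ (p - 1)"
    using s(2) by (simp add: algebra_simps)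
  also have "lam ^ (p - 1) = lam ^ Suc k * lam ^ (p - 1 - Suc k)"
    using Suc.prems by (metis le_add_diff_inverse power_add)
  also have "of_nat p * lam * s = lam ^ Suc k * (w * s)" by (simp add: w(2))
  finally have "of_nat p = lam ^ Suc k * (w * s - lam ^ (p - 1 - Suc k))"
    by (simp add: algebra_simps)
  with w s show ?case by (intro bexI[of _ "w * s - lam ^ (p - 1 - Suc k)"]) auto
qed

lemma p_dvd_lam_pow: "\<exists>w\<in>OK. lam ^ (p - 1) = of_nat p * w"
proof -
  obtain s where s: "s \<in> OK" "of_nat p * (1 - lam * s) = - (lam ^ (p - 1))" by (rule p_times_unit)
  have "lam ^ (p - 1) = of_nat p * - (1 - lam * s)"
    using s(2) by (metis minus_minus mult_minus_right)
  with s show ?thesis by (intro bexI[of _ "- (1 - lam * s)"]) auto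
qed

section \<open>Congruences modulo powers of the prime above \<open>p\<close>\<close>

lemma cong_lam_refl [simp, intro]: "cong_lam k x x"
  unfolding cong_lam_def by (intro bexI[of _ 0]) auto

lemma cong_lam_0 [simp]: "cong_lam 0 x y \<longleftrightarrow> x - y \<in> OK"
  by (simp add: cong_lam_def)

lemma cong_lam_sym: "cong_lam k x y \<Longrightarrow> cong_lam k y x"
  unfolding cong_lam_def by (metis cyc_ints_uminus minus_diff_eq mult_minus_right)

lemma cong_lam_add: "cong_lam k x y \<Longrightarrow> cong_lam k x' y' \<Longrightarrow> cong_lam k (x + x') (y + y')"
  unfolding cong_lam_def by (metis cyc_ints_add add_diff_add distrib_left)

lemma cong_lam_uminus: "cong_lam k x y \<Longrightarrow> cong_lam k (- x) (- y)"
  unfolding cong_lam_def by (metis cyc_ints_uminus minus_diff_minus mult_minus_right)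

lemma cong_lam_diff: "cong_lam k x y \<Longrightarrow> cong_lam k x' y' \<Longrightarrow> cong_lam k (x - x') (y - y')"
  using cong_lam_add[of k x y "- x'" "- y'"] cong_lam_uminus by simp

lemma cong_lam_trans [trans]: "cong_lam k x y \<Longrightarrow> cong_lam k y z \<Longrightarrow> cong_lam k x z"
  using cong_lam_add[of k x y y z] unfolding cong_lam_def by simp

lemma cong_lam_iff_diff: "cong_lam k x y \<longleftrightarrow> cong_lam k (x - y) 0"
  by (simp add: cong_lam_def)

lemma cong_lam_sum: "(\<And>i. i \<in> A \<Longrightarrow> cong_lam k (f i) (g i)) \<Longrightarrow> cong_lam k (sum f A) (sum g A)"
  by (induction A rule: infinite_finite_induct) (auto intro: cong_lam_add)

lemma cong_lam_mult_left: "cong_lam k x y \<Longrightarrow> a \<in> OK \<Longrightarrow> cong_lam k (a * x) (a * y)"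
  unfolding cong_lam_def by (auto intro!: bexI[of _ "a * _"] simp flip: right_diff_distrib)

lemma cong_lam_mult:
  assumes "cong_lam k x y" "cong_lam k x' y'" "x \<in> OK" "y' \<in> OK"
  shows "cong_lam k (x * x') (y * y')"
proof -
  have "cong_lam k (x * x') (x * y')" using assms by (intro cong_lam_mult_left)
  also have "cong_lam k (x * y') (y * y')" using cong_lam_mult_left[OF assms(1,4)] by (simp add: mult.commute)
  finally show ?thesis .
qed

lemma cong_lam_power:
  "cong_lam k x y \<Longrightarrow> x \<in> OK \<Longrightarrow> y \<in> OK \<Longrightarrow> cong_lam k (x ^ n) (y ^ n)"
  by (induction n) (auto intro: cong_lam_mult)

lemma cong_lam_mono:
  assumes "cong_lam k x y" "j \<le> k"
  shows "cong_lam j x y"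
proof -
  from assms obtain z where "z \<in> OK" "x - y = lam ^ k * z" by (auto simp: cong_lam_def)
  moreover have "lam ^ k = lam ^ j * lam ^ (k - j)" using assms(2) by (simp flip: power_add)
  ultimately show ?thesis unfolding cong_lam_def by (intro bexI[of _ "lam ^ (k - j) * z"]) auto
qed

lemma cong_lam_shift: "cong_lam (j + k) (lam ^ j * x) (lam ^ j * y) \<longleftrightarrow> cong_lam k x y"
  using lam_neq_0 by (simp add: cong_lam_def power_add mult.assoc flip: right_diff_distrib)

section \<open>Integers modulo \<open>lam\<close>, the residue field, and the
  \<open>lam\<close>-adic valuation\<close>

lemma cong_lam_p_multiple: "x \<in> OK \<Longrightarrow> cong_lam (p - 1) (of_nat p * x) 0"
  using lam_pow_dvd_p[of "p - 1"] unfolding cong_lam_def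
  by (metis cyc_ints_mult diff_zero mult.assoc order_refl)

lemma cong_lam_of_int:
  assumes "[a = b] (mod int p)"
  shows "cong_lam (p - 1) (of_int a) (of_int b)"
proof -
  from assms obtain c where "a - b = int p * c" by (auto simp: cong_iff_dvd_diff)
  hence "of_int a - of_int b = of_nat p * (of_int c :: complex)" by (metis of_int_diff of_int_mult of_int_of_nat_eq)
  thus ?thesis using cong_lam_p_multiple[of "of_int c"] by (simp add: cong_lam_iff_diff[of _ "of_int a"])
qed

text \<open>Otherwise Bezout makes \<open>lam\<close> a divisor of 1. Taking the power
  \<open>p - 1\<close> makes \<open>p\<close> a divisor of 1 in \<open>OK\<close>, hence in the
  integers.\<close>

lemma cong_lam_one_int_0:
  assumes "cong_lam 1 (of_int n) 0"
  shows "int p dvd n"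
proof (rule ccontr)
  assume "\<not> int p dvd n"
  hence "coprime (int p) n" using prime_p by (simp add: prime_imp_coprime)
  then obtain a b where ab: "a * int p + b * n = 1" using bezout_int[of "int p" n] by auto
  have "cong_lam 1 (of_nat p * of_int a) 0"
    using p_ge_3 by (intro cong_lam_mono[OF cong_lam_p_multiple]) auto
  from cong_lam_add[OF this cong_lam_mult_left[OF assms, of "of_int b"]]
  have "cong_lam 1 (of_int (a * int p + b * n)) 0" by (simp add: mult.commute)
  then obtain y where y: "y \<in> OK" "1 = lam * y" unfolding ab by (auto simp: cong_lam_def)
  obtain w where w: "w \<in> OK" "lam ^ (p - 1) = of_nat p * w" using p_dvd_lam_pow by blast
  have "1 = (lam * y) ^ (p - 1)" using y(2) by simp
  also have "\<dots> = of_nat p * (w * y ^ (p - 1))" by (simp only: power_mult_distrib w(2) mult.assoc)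
  finally have "int p dvd 1"
    using y w p_ge_3 by (intro OK_int_dvd[of "w * y ^ (p - 1)"]) auto
  with p_ge_3 show False by simp
qed

lemma cong_lam_one_int_iff: "cong_lam 1 (of_int a) (of_int b) \<longleftrightarrow> [a = b] (mod int p)"
proof
  assume "cong_lam 1 (of_int a) (of_int b)"
  hence "cong_lam 1 (of_int (a - b)) 0" by (simp add: cong_lam_iff_diff[of _ "of_int a"])
  thus "[a = b] (mod int p)" using cong_lam_one_int_0 by (simp add: cong_iff_dvd_diff)
next
  assume "[a = b] (mod int p)"
  from cong_lam_mono[OF cong_lam_of_int[OF this], of 1] p_ge_3
  show "cong_lam 1 (of_int a) (of_int b)" by simp
qed

text \<open>Since \<zeta> is 1 modulo \<open>lam\<close>, the sum of the coordinates is a residue;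
  so the residue field consists of the integers modulo \<open>p\<close>.\<close>

lemma OK_residue:
  assumes "x \<in> OK"
  shows "\<exists>n::int. cong_lam 1 x (of_int n)"
proof -
  have zeta: "cong_lam 1 \<zeta> 1" unfolding cong_lam_def by (intro bexI[of _ "-1"]) (auto simp: lam_def)
  from OK_as_sum[OF assms] obtain c :: "nat \<Rightarrow> int" where c: "x = (\<Sum>k<p. of_int (c k) * \<zeta> ^ k)" by blast
  have "cong_lam 1 x (\<Sum>k<p. of_int (c k) * 1 ^ k)"
    unfolding c using zeta by (intro cong_lam_sum cong_lam_mult_left cong_lam_power) auto
  thus ?thesis by (intro exI[of _ "\<Sum>k<p. c k"]) simp
qed

text \<open>Replacing both factors by integer residues reduces this to the primality of
  \<open>p\<close>.\<close>

lemma lam_prime: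
  assumes "cong_lam 1 (x * y) 0" "x \<in> OK" "y \<in> OK"
  shows "cong_lam 1 x 0 \<or> cong_lam 1 y 0"
proof -
  obtain m n :: int where mn: "cong_lam 1 x (of_int m)" "cong_lam 1 y (of_int n)"
    using OK_residue assms by blast
  have "cong_lam 1 (of_int (m * n)) (x * y)"
    using mn assms by (auto intro!: cong_lam_mult intro: cong_lam_sym)
  from cong_lam_trans[OF this assms(1)] have "int p dvd m * n" by (rule cong_lam_one_int_0)
  hence "int p dvd m \<or> int p dvd n" using prime_p by (simp add: prime_dvd_mult_iff)
  hence "cong_lam 1 (of_int m) (of_int 0) \<or> cong_lam 1 (of_int n) (of_int 0)"
    unfolding cong_lam_one_int_iff by (simp add: cong_0_iff)
  thus ?thesis using mn cong_lam_trans by auto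
qed

text \<open>By \<open>lam_prime\<close> the whole power of \<open>lam\<close> sits in
  \<open>x\<close>; the induction removes one factor at a time.\<close>

lemma cong_lam_cancel:
  assumes "cong_lam k (x * y) 0" "\<not> cong_lam 1 y 0" "x \<in> OK" "y \<in> OK"
  shows "cong_lam k x 0"
  using assms
proof (induction k arbitrary: x)
  case 0
  thus ?case by simp
next
  case (Suc k)
  have "cong_lam 1 (x * y) 0" using Suc.prems(1) by (rule cong_lam_mono) simp
  then obtain x' where x': "x' \<in> OK" "x = lam * x'"
    using lam_prime[of x y] Suc.prems by (auto simp: cong_lam_def)
  have "cong_lam (1 + k) (lam ^ 1 * (x' * y)) (lam ^ 1 * 0)"
    using Suc.prems(1) by (simp add: x' mult.assoc)
  hence "cong_lam k x' 0"
    unfolding cong_lam_shift using Suc x' by blast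
  hence "cong_lam (1 + k) (lam ^ 1 * x') (lam ^ 1 * 0)" unfolding cong_lam_shift .
  thus ?case by (simp add: x')
qed

text \<open>A nonzero \<open>x\<close> divides a nonzero integer \<open>n\<close>. Too many factors
  \<open>lam\<close> in \<open>x\<close> would force \<open>p ^ N\<close> to divide \<open>n\<close>
  for \<open>N = \<bar>n\<bar>\<close>, although \<open>p ^ N > N\<close>.\<close>

lemma lam_multiplicity_finite:
  assumes "x \<in> OK" "x \<noteq> 0"
  shows "\<exists>N. \<not> cong_lam N x 0"
proof (rule ccontr)
  assume *: "\<not> ?thesis"
  obtain y n where y: "y \<in> OK" "n \<noteq> 0" "x * y = of_int n" using OK_dvd_int[OF assms] .
  define N where "N = nat \<bar>n\<bar>"
  from * obtain z where z: "z \<in> OK" "x = lam ^ ((p - 1) * N) * z" by (auto simp: cong_lam_def)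
  obtain w where w: "w \<in> OK" "lam ^ (p - 1) = of_nat p * w" using p_dvd_lam_pow by blast
  have "of_int n = of_int (int p ^ N) * (w ^ N * z * y)"
    unfolding y(3)[symmetric] z(2) power_mult w(2) by (simp add: power_mult_distrib)
  hence "int p ^ N dvd n" using y z w p_ge_3 by (intro OK_int_dvd[of "w ^ N * z * y"]) auto
  hence "int p ^ N \<le> int N" using y(2) unfolding N_def by (simp add: zdvd_imp_le dvd_imp_le_int)
  moreover have "int N < int p ^ N"
    by (rule less_le_trans[OF of_nat_less_two_power power_mono]) (use p_ge_3 in auto)
  ultimately show False by simp
qed

text \<open>In the binomial expansion of \<open>(y + lam * z) ^ p\<close> a middle term has
  \<open>lam ^ (p - 1)\<close> from \<open>p\<close> and at least one further \<open>lam\<close>;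
  the last term is \<open>lam ^ p * z ^ p\<close>.\<close>

lemma cong_lam_pow_p:
  assumes "cong_lam 1 x y" "x \<in> OK" "y \<in> OK"
  shows "cong_lam p (x ^ p) (y ^ p)"
proof -
  from assms(1) obtain z where z: "z \<in> OK" "x - y = lam * z" by (auto simp: cong_lam_def)
  define f where "f k = of_nat (p choose k) * (lam * z) ^ k * y ^ (p - k)" for k
  have "x = lam * z + y" using z(2) by (simp add: algebra_simps)
  hence "x ^ p = (\<Sum>k\<le>p. f k)"
    unfolding f_def by (simp only: binomial_ring)
  also have "{..p} = insert 0 {1..p}" by auto
  also have "sum f (insert 0 {1..p}) = y ^ p + (\<Sum>k=1..p. f k)" by (simp add: f_def)
  finally have "x ^ p - y ^ p = (\<Sum>k=1..p. f k)" by simp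
  moreover have "cong_lam p (\<Sum>k=1..p. f k) (\<Sum>k=1..p. 0)"
  proof (rule cong_lam_sum)
    fix k assume k: "k \<in> {1..p}"
    show "cong_lam p (f k) 0"
    proof (cases "k = p")
      case True
      thus ?thesis using z(1) by (auto simp: f_def cong_lam_def power_mult_distrib)
    next
      case False
      hence "p dvd p choose k" using k prime_p by (intro dvd_choose_prime) auto
      then obtain c where c: "p choose k = p * c" by (elim dvdE)
      have "lam ^ k = lam * lam ^ (k - 1)"
        using k by (cases k) auto
      hence f: "f k = lam ^ 1 * (of_nat p * (of_nat c * lam ^ (k - 1) * z ^ k * y ^ (p - k)))"
        by (simp add: f_def c power_mult_distrib)
      have "cong_lam (1 + (p - 1)) (f k) (lam ^ 1 * 0)"
        unfolding f cong_lam_shift using z(1) assms(3) by (intro cong_lam_p_multiple) auto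
      thus ?thesis using p_ge_3 by simp
    qed
  qed
  ultimately show ?thesis by (simp add: cong_lam_iff_diff[of _ "x ^ p"])
qed

lemma OK_residue_nat:
  assumes "x \<in> OK"
  shows "\<exists>n::nat. cong_lam 1 x (of_nat n)"
proof -
  obtain n :: int where n: "cong_lam 1 x (of_int n)" using OK_residue[OF assms] by blast
  have "cong_lam 1 (of_int n) (of_int (n mod int p))"
    unfolding cong_lam_one_int_iff by (simp add: cong_def)
  moreover have "n mod int p = int (nat (n mod int p))" using p_ge_3 by simp
  ultimately have "cong_lam 1 (of_int n) (of_nat (nat (n mod int p)))" by (metis of_int_of_nat_eq)
  with n show ?thesis by (blast intro: cong_lam_trans)
qed

lemma cong_lam_one_nat_iff: "cong_lam 1 (of_nat a) (of_nat b) \<longleftrightarrow> [a = b] (mod p)"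
  using cong_lam_one_int_iff[of "int a" "int b"] by (simp add: cong_int_iff)

lemma cong_lam_one_nat_0: "cong_lam 1 (of_nat a) 0 \<longleftrightarrow> p dvd a"
  using cong_lam_one_nat_iff[of a 0] by (simp add: cong_0_iff)

lemma cong_lam_fermat:
  assumes "a \<in> OK" "\<not> cong_lam 1 a 0"
  shows "cong_lam 1 (a ^ (p - 1)) 1"
proof -
  obtain n :: nat where n: "cong_lam 1 a (of_nat n)" using OK_residue_nat[OF assms(1)] by blast
  with assms(2) have "\<not> p dvd n" by (auto simp flip: cong_lam_one_nat_0 intro: cong_lam_trans)
  hence "[n ^ (p - 1) = 1] (mod p)" using prime_p by (intro fermat_theorem)
  hence "cong_lam 1 (of_nat (n ^ (p - 1))) (of_nat 1)" by (simp only: cong_lam_one_nat_iff)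
  moreover have "cong_lam 1 (a ^ (p - 1)) (of_nat n ^ (p - 1))"
    using n assms(1) by (intro cong_lam_power) auto
  ultimately show ?thesis by (auto intro: cong_lam_trans)
qed

lemma cong_lam_fermat_p:
  assumes "a \<in> OK" "\<not> cong_lam 1 a 0"
  shows "cong_lam p (a ^ (p * (p - 1))) 1"
  using cong_lam_pow_p[OF cong_lam_fermat[OF assms]] assms(1)
  by (simp add: mult.commute[of p] power_mult)

lemma lam_prime_power:
  assumes "cong_lam 1 (x ^ n) 0" "x \<in> OK"
  shows "cong_lam 1 x 0"
  using assms
proof (induction n)
  case 0
  thus ?case using cong_lam_one_nat_0[of 1] p_ge_3 by simp
next
  case (Suc n)
  thus ?case using lam_prime[of x "x ^ n"] by auto
qed

lemma lam_factor:
  assumes "cong_lam 1 x 0"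
  obtains y where "y \<in> OK" "x = lam * y"
  using assms by (auto simp: cong_lam_def)

text \<open>The factor \<open>\<alpha> ^ p\<close> is invisible modulo \<open>lam ^ p\<close> after
  the power \<open>p - 1\<close>. Since \<beta> and \<gamma> are \<pi>-units, \<alpha> is a quotient
  \<open>a / b\<close> of \<pi>-units, and both \<open>a ^ (p * (p - 1))\<close> and
  \<open>b ^ (p * (p - 1))\<close> are 1 by \<open>cong_lam_fermat_p\<close>.\<close>

lemma cong_lam_of_pth_power_ratio:
  assumes "\<alpha> \<in> carrier (cyc_field \<zeta>)" "\<beta> \<in> OK" "\<gamma> \<in> OK"
    and unit: "\<not> cong_lam 1 \<beta> 0" "\<not> cong_lam 1 \<gamma> 0"
    and eq: "\<gamma> = \<beta> * \<alpha> ^ p"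
  shows "cong_lam p (\<gamma> ^ (p - 1)) (\<beta> ^ (p - 1))"
proof -
  \<comment> \<open>\<open>N\<close> bounds the multiplicity of \<open>lam\<close> in
    \<open>b\<close>; each round cancels one \<open>lam\<close> from numerator and
    denominator.\<close>
  have reduce: "\<exists>a\<in>OK. \<exists>b\<in>OK. \<not> cong_lam 1 b 0 \<and> \<alpha> = a / b"
    if "a \<in> OK" "b \<in> OK" "\<not> cong_lam N b 0" "\<alpha> = a / b" for a b N
    using that
  proof (induction N arbitrary: a b)
    case 0
    thus ?case by simp
  next
    case (Suc N)
    show ?case
    proof (cases "cong_lam 1 b 0")
      case False
      with Suc.prems show ?thesis by blast
    next
      case True
      then obtain b' where b': "b' \<in> OK" "b = lam * b'" by (rule lam_factor)
      have "b \<noteq> 0" using Suc.prems(3) by auto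
      \<comment> \<open>The equation transfers divisibility by \<open>lam\<close> from
        \<open>b\<close> to \<open>a\<close>, as \<beta> is a \<pi>-unit.\<close>
      hence "\<beta> * a ^ p = \<gamma> * b ^ p" by (simp add: eq Suc.prems(4) power_divide)
      also have "cong_lam 1 (\<gamma> * b ^ p) (\<gamma> * 0 ^ p)"
        using True assms Suc.prems by (intro cong_lam_mult_left cong_lam_power) auto
      finally have "cong_lam 1 (\<beta> * a ^ p) 0" using p_ge_3 by (simp add: power_0_left)
      hence "cong_lam 1 a 0"
        using lam_prime[of \<beta> "a ^ p"] lam_prime_power[of a p] unit assms Suc.prems by auto
      then obtain a' where a': "a' \<in> OK" "a = lam * a'" by (rule lam_factor)
      have "\<alpha> = a' / b'" using Suc.prems(4) a' b' lam_neq_0 by simp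
      moreover have "\<not> cong_lam N b' 0"
        using Suc.prems(3) cong_lam_shift[of 1 N b' 0] b' by simp
      ultimately show ?thesis using Suc.IH a' b' by blast
    qed
  qed
  obtain a b where "a \<in> OK" "b \<in> OK" "b \<noteq> 0" "\<alpha> = a / b"
    using cyc_field_as_fraction[OF assms(1)] .
  with lam_multiplicity_finite[of b] reduce
  obtain a b where ab: "a \<in> OK" "b \<in> OK" "\<not> cong_lam 1 b 0" "\<alpha> = a / b" by metis
  have "b \<noteq> 0" using ab(3) by auto
  hence eq': "\<beta> * a ^ p = \<gamma> * b ^ p" by (simp add: eq ab(4) power_divide)
  have "\<not> cong_lam 1 a 0"
  proof
    assume "cong_lam 1 a 0"
    hence "cong_lam 1 (\<beta> * a ^ p) (\<beta> * 0 ^ p)"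
      using ab assms by (intro cong_lam_mult_left cong_lam_power) auto
    hence "cong_lam 1 (\<gamma> * b ^ p) 0" using p_ge_3 by (simp add: eq' power_0_left)
    thus False
      using lam_prime[of \<gamma> "b ^ p"] lam_prime_power[of b p] unit assms ab by auto
  qed
  have "cong_lam p (\<gamma> ^ (p - 1) * b ^ (p * (p - 1))) (\<gamma> ^ (p - 1) * 1)"
    using ab assms by (intro cong_lam_mult_left cong_lam_fermat_p) auto
  hence "cong_lam p (\<gamma> ^ (p - 1)) (\<gamma> ^ (p - 1) * b ^ (p * (p - 1)))"
    by (simp add: cong_lam_sym)
  also have "\<gamma> ^ (p - 1) * b ^ (p * (p - 1)) = \<beta> ^ (p - 1) * a ^ (p * (p - 1))"
    using eq' by (metis power_mult power_mult_distrib)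
  also have "cong_lam p (\<beta> ^ (p - 1) * a ^ (p * (p - 1))) (\<beta> ^ (p - 1) * 1)"
    using ab assms \<open>\<not> cong_lam 1 a 0\<close> by (intro cong_lam_mult_left cong_lam_fermat_p) auto
  finally show ?thesis by simp
qed

text \<open>All binomial terms beyond the linear one contain \<open>(A - 1) ^ 2\<close>, a multiple
  of \<open>lam ^ (2 * k)\<close>.\<close>

lemma cong_lam_power_linear:
  assumes "A \<in> OK" "cong_lam k A 1"
  shows "cong_lam (2 * k) (A ^ n) (1 + of_nat n * (A - 1))"
proof (induction n)
  case 0
  show ?case by simp
next
  case (Suc n)
  obtain y where y: "y \<in> OK" "A - 1 = lam ^ k * y" using assms by (auto simp: cong_lam_def)
  have "(A - 1) ^ 2 = lam ^ (2 * k) * y ^ 2"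
    by (simp add: y(2) power_mult_distrib flip: power_mult) (simp add: mult.commute)
  hence sq: "cong_lam (2 * k) (of_nat n * (A - 1) ^ 2) (of_nat n * 0)"
    using y(1) by (intro cong_lam_mult_left) (auto simp: cong_lam_def)
  have "cong_lam (2 * k) (A ^ Suc n) (A * (1 + of_nat n * (A - 1)))"
    using cong_lam_mult_left[OF Suc assms(1)] by simp
  also have "A * (1 + of_nat n * (A - 1)) = (1 + of_nat (Suc n) * (A - 1)) + of_nat n * (A - 1) ^ 2"
    by (simp add: algebra_simps power2_eq_square)
  also have "cong_lam (2 * k) \<dots> ((1 + of_nat (Suc n) * (A - 1)) + of_nat n * 0)"
    by (intro cong_lam_add sq cong_lam_refl)
  finally show ?case by simp
qed

section \<open>Translation of \<open>pi_cong\<close> into congruences modulo powers of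
  \<open>lam\<close>\<close>

lemma prime_pi_eq: "prime_pi \<zeta> = {x. cong_lam 1 x 0}"
  by (auto simp: prime_pi_def l_coset_def cong_lam_def lam_def)

lemma prime_pi_pow_eq: "prime_pi_pow \<zeta> k = {x. cong_lam k x 0}"
proof (induction k)
  case 0
  show ?case by (simp add: prime_pi_pow_def nat_pow_def ideals_set_def)
next
  case (Suc k)
  have "prime_pi_pow \<zeta> (Suc k) = ideal_prod (cyc_ints \<zeta>) {x. cong_lam k x 0} {x. cong_lam 1 x 0}"
    using Suc by (simp add: prime_pi_pow_def nat_pow_def ideals_set_def prime_pi_eq)
  also have "\<dots> = {x. cong_lam (Suc k) x 0}"
  proof (intro equalityI subsetI CollectI)
    fix x assume "x \<in> ideal_prod (cyc_ints \<zeta>) {x. cong_lam k x 0} {x. cong_lam 1 x 0}"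
    thus "cong_lam (Suc k) x 0"
    proof (induction rule: ideal_prod.induct)
      case (prod i j)
      then obtain y z where "y \<in> OK" "z \<in> OK" "i = lam ^ k * y" "j = lam * z"
        by (auto simp: cong_lam_def)
      thus ?case by (auto simp: cong_lam_def intro!: bexI[of _ "y * z"])
    next
      case (sum s t)
      thus ?case using cong_lam_add[of "Suc k" s 0 t 0] by simp
    qed
  next
    fix x assume "x \<in> {x. cong_lam (Suc k) x 0}"
    then obtain y where y: "y \<in> OK" "x = lam ^ k * (lam * y)" by (auto simp: cong_lam_def)
    have "cong_lam k (lam ^ k) 0" unfolding cong_lam_def by (intro bexI[of _ 1]) auto
    moreover have "cong_lam 1 (lam * y) 0" using y unfolding cong_lam_def by (intro bexI[of _ y]) auto
    ultimately show "x \<in> ideal_prod (cyc_ints \<zeta>) {x. cong_lam k x 0} {x. cong_lam 1 x 0}"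
      using ideal_prod.prod[of "lam ^ k" "{x. cong_lam k x 0}" "lam * y" "{x. cong_lam 1 x 0}" "cyc_ints \<zeta>"] y
      by simp
  qed
  finally show ?case .
qed

lemma pi_localI:
  assumes "cong_lam k a 0" "b \<in> OK" "\<not> cong_lam 1 b 0"
  shows "a / b \<in> pi_local \<zeta> k"
  using assms by (auto simp: pi_local_def prime_pi_eq prime_pi_pow_eq)

text \<open>A denominator from outside \<pi> can be cancelled by \<open>cong_lam_cancel\<close>, so
  localising creates no new congruences on \<open>OK\<close>.\<close>

lemma pi_cong_OK_iff:
  assumes "x \<in> OK" "y \<in> OK"
  shows "pi_cong \<zeta> k x y \<longleftrightarrow> cong_lam k x y"
proof -
  have one: "\<not> cong_lam 1 1 0" using cong_lam_one_nat_0[of 1] p_ge_3 by simp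
  have int: "z \<in> pi_local \<zeta> 0" if "z \<in> OK" for z
    using pi_localI[of 0 z 1] one that by simp
  have "x - y \<in> pi_local \<zeta> k \<longleftrightarrow> cong_lam k x y"
  proof
    assume "x - y \<in> pi_local \<zeta> k"
    then obtain a b where ab: "cong_lam k a 0" "b \<in> OK" "\<not> cong_lam 1 b 0" "x - y = a / b"
      by (auto simp: pi_local_def prime_pi_eq prime_pi_pow_eq)
    have "b \<noteq> 0" using ab(3) by auto
    with ab have "cong_lam k ((x - y) * b) 0" by simp
    hence "cong_lam k (x - y) 0" using ab(2,3) assms by (intro cong_lam_cancel[of k "x - y" b]) simp_all
    thus "cong_lam k x y" by (subst cong_lam_iff_diff)
  next
    assume "cong_lam k x y"
    hence "cong_lam k (x - y) 0" by (subst (asm) cong_lam_iff_diff)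
    from pi_localI[OF this _ one] show "x - y \<in> pi_local \<zeta> k" by simp
  qed
  with int assms show ?thesis by (auto simp: pi_cong_def)
qed

end

section \<open>Galois action\<close>

locale prime_cyclotomic_galois = prime_cyclotomic +
  fixes u :: nat and \<sigma> :: "complex \<Rightarrow> complex"
  assumes primroot: "residue_primroot p u"
    and galois: "\<sigma> \<in> Gal_rat (cyc_field \<zeta>)"
    and sigma_zeta: "\<sigma> \<zeta> = \<zeta> ^ u"
begin

lemma sigma_add: "x \<in> OK \<Longrightarrow> y \<in> OK \<Longrightarrow> \<sigma> (x + y) = \<sigma> x + \<sigma> y"
  and sigma_mult: "x \<in> OK \<Longrightarrow> y \<in> OK \<Longrightarrow> \<sigma> (x * y) = \<sigma> x * \<sigma> y"
  using galois
  by (auto simp: Gal_rat_def ring_iso_def Ring.ring_hom_def dest!: subsetD[OF cyc_ints_subset_cyc_field])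

lemma sigma_of_int [simp]: "\<sigma> (of_int n) = of_int n"
  and sigma_of_nat [simp]: "\<sigma> (of_nat m) = of_nat m"
  and sigma_0 [simp]: "\<sigma> 0 = 0"
  and sigma_1 [simp]: "\<sigma> 1 = 1"
  using galois by (auto simp: Gal_rat_def)

lemma sigma_power: "x \<in> OK \<Longrightarrow> \<sigma> (x ^ n) = \<sigma> x ^ n"
  by (induction n) (auto simp: sigma_mult)

lemma sigma_sum: "(\<And>i. i \<in> A \<Longrightarrow> f i \<in> OK) \<Longrightarrow> \<sigma> (sum f A) = (\<Sum>i\<in>A. \<sigma> (f i))"
  by (induction A rule: infinite_finite_induct) (auto simp: sigma_add)

text \<open>The exponents \<open>e k\<close> are kept general so that the rule applies to its own
  result when \<sigma> is iterated.\<close>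

lemma sigma_zeta_sum:
  "\<sigma> (\<Sum>k\<in>A. of_int (c k) * \<zeta> ^ e k) = (\<Sum>k\<in>A. of_int (c k) * \<zeta> ^ (e k * u))"
  by (subst sigma_sum)
     (auto simp: sigma_mult sigma_power sigma_zeta mult.commute[of _ u] simp flip: power_mult)

lemma sigma_iter_zeta_sum:
  "(\<sigma> ^^ i) (\<Sum>k\<in>A. of_int (c k) * \<zeta> ^ k) = (\<Sum>k\<in>A. of_int (c k) * \<zeta> ^ (k * u ^ i))"
  by (induction i) (simp_all add: sigma_zeta_sum mult.assoc mult.commute[of u])

lemma sigma_OK [intro, simp]:
  assumes "x \<in> OK"
  shows "\<sigma> x \<in> OK"
proof -
  from OK_as_sum[OF assms] obtain c :: "nat \<Rightarrow> int" where "x = (\<Sum>k<p. of_int (c k) * \<zeta> ^ k)" by blast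
  thus ?thesis using sigma_zeta_sum[of c "\<lambda>k. k" "{..<p}"] by auto
qed

lemma sigma_iter_OK [intro, simp]: "x \<in> OK \<Longrightarrow> (\<sigma> ^^ i) x \<in> OK"
  by (induction i) auto

lemma sigma_diff: "x \<in> OK \<Longrightarrow> y \<in> OK \<Longrightarrow> \<sigma> (x - y) = \<sigma> x - \<sigma> y"
  using sigma_add[of "x - y" y] by simp

text \<open>The cofactor is the geometric sum \<open>\<Sum>i<u. \<zeta> ^ i\<close> of
  \<open>u\<close> terms, each 1 modulo \<open>lam\<close>. Hence \<sigma> multiplies a leading
  coefficient at \<open>lam ^ k\<close> by \<open>u ^ k\<close>.\<close>

lemma sigma_lam: "\<exists>w\<in>OK. \<sigma> lam = lam * w \<and> cong_lam 1 w (of_nat u)"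
proof -
  have "\<sigma> lam = 1 - \<zeta> ^ u" by (simp add: lam_def sigma_diff sigma_zeta)
  hence "\<sigma> lam = lam * (\<Sum>i<u. \<zeta> ^ i)" by (simp add: lam_def one_diff_power_eq)
  moreover have "cong_lam 1 \<zeta> 1" unfolding cong_lam_def by (intro bexI[of _ "-1"]) (auto simp: lam_def)
  hence "cong_lam 1 (\<Sum>i<u. \<zeta> ^ i) (\<Sum>i<u. 1 ^ i)"
    by (intro cong_lam_sum cong_lam_power) auto
  ultimately show ?thesis by (intro bexI[of _ "\<Sum>i<u. \<zeta> ^ i"]) auto
qed

lemma sigma_cong:
  assumes "cong_lam k x y" "x \<in> OK" "y \<in> OK"
  shows "cong_lam k (\<sigma> x) (\<sigma> y)"
proof -
  obtain z where z: "z \<in> OK" "x - y = lam ^ k * z" using assms(1) by (auto simp: cong_lam_def)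
  obtain w where w: "w \<in> OK" "\<sigma> lam = lam * w" using sigma_lam by blast
  have "\<sigma> x - \<sigma> y = \<sigma> (lam ^ k * z)" using assms z by (metis sigma_diff)
  also have "\<dots> = lam ^ k * (w ^ k * \<sigma> z)" using z w by (simp add: sigma_mult sigma_power power_mult_distrib)
  finally show ?thesis using z w unfolding cong_lam_def by (intro bexI[of _ "w ^ k * \<sigma> z"]) auto
qed

text \<open>With \<open>A = 1 + lam ^ k * y\<close>, comparing \<open>\<sigma> A\<close> with
  \<open>A ^ \<mu>\<close> modulo \<open>lam ^ (k + 1)\<close> shows that \<open>u ^ k * y\<close>
  and \<open>\<mu> * y\<close> agree modulo \<open>lam\<close>, so \<open>lam\<close> divides
  \<open>y\<close>.\<close>

lemma sigma_eigen_step: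
  assumes A: "A \<in> OK" and eigen: "cong_lam p (\<sigma> A) (A ^ \<mu>)"
    and k: "1 \<le> k" "k < p" "cong_lam k A 1" and neq: "\<not> [u ^ k = \<mu>] (mod p)"
  shows "cong_lam (Suc k) A 1"
proof -
  obtain y where y: "y \<in> OK" "A - 1 = lam ^ k * y" using k(3) by (auto simp: cong_lam_def)
  obtain w where w: "w \<in> OK" "\<sigma> lam = lam * w" "cong_lam 1 w (of_nat u)" using sigma_lam by blast
  obtain n :: int where n: "cong_lam 1 y (of_int n)" using OK_residue[OF y(1)] by blast
  have "A = 1 + lam ^ k * y" using y(2) by (simp add: algebra_simps)
  hence "\<sigma> A = 1 + lam ^ k * (w ^ k * \<sigma> y)"
    using y(1) w(1,2) by (simp add: sigma_add sigma_mult sigma_power power_mult_distrib)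
  moreover have "cong_lam (k + 1) (\<sigma> A) (A ^ \<mu>)" using k by (intro cong_lam_mono[OF eigen]) auto
  \<comment> \<open>The quadratic error has order \<open>2 * k\<close>, which is at least
    \<open>k + 1\<close> because \<open>k \<ge> 1\<close>.\<close>
  moreover have "cong_lam (k + 1) (A ^ \<mu>) (1 + of_nat \<mu> * (A - 1))"
    using k by (intro cong_lam_mono[OF cong_lam_power_linear[OF A k(3)]]) auto
  ultimately have "cong_lam (k + 1) (1 + lam ^ k * (w ^ k * \<sigma> y)) (1 + of_nat \<mu> * (A - 1))"
    by (metis cong_lam_trans)
  hence "cong_lam (k + 1) (lam ^ k * (w ^ k * \<sigma> y)) (lam ^ k * (of_nat \<mu> * y))"
    unfolding y(2) by (subst cong_lam_iff_diff, subst (asm) cong_lam_iff_diff) (simp add: mult.left_commute)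
  hence eq: "cong_lam 1 (w ^ k * \<sigma> y) (of_nat \<mu> * y)"
    unfolding cong_lam_shift .
  \<comment> \<open>\<sigma> fixes the integer residue \<open>n\<close> of \<open>y\<close>, so the
    two sides differ only in the factors \<open>u ^ k\<close> and \<mu>.\<close>
  have "cong_lam 1 (of_nat u ^ k * of_int n) (w ^ k * \<sigma> y)"
    using w(1) sigma_cong[OF n y(1)]
    by (intro cong_lam_mult cong_lam_power cong_lam_sym[OF w(3)]) (auto intro: cong_lam_sym simp: y)
  also note eq
  also have "cong_lam 1 (of_nat \<mu> * y) (of_nat \<mu> * of_int n)"
    by (intro cong_lam_mult_left n) auto
  finally have "cong_lam 1 (of_int (int u ^ k * n)) (of_int (int \<mu> * n))" by simp
  hence "int p dvd (int (u ^ k) - int \<mu>) * n"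
    unfolding cong_lam_one_int_iff by (simp add: cong_iff_dvd_diff left_diff_distrib)
  moreover have "\<not> int p dvd int (u ^ k) - int \<mu>"
    using neq unfolding cong_iff_dvd_diff[symmetric] cong_int_iff .
  ultimately have "int p dvd n" using prime_p by (simp add: prime_dvd_mult_iff)
  hence "cong_lam 1 (of_int n) (of_int 0)" unfolding cong_lam_one_int_iff by (simp add: cong_0_iff)
  with n have "cong_lam 1 y 0" by (auto intro: cong_lam_trans)
  hence "cong_lam (k + 1) (lam ^ k * y) (lam ^ k * 0)" unfolding cong_lam_shift .
  hence "cong_lam (Suc k) (A - 1) 0" by (simp add: y(2))
  thus ?thesis by (subst cong_lam_iff_diff)
qed

lemma sigma_eigen_cong:
  assumes "A \<in> OK" "cong_lam p (\<sigma> A) (A ^ \<mu>)" "cong_lam 1 A 1"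
    and "1 \<le> k" "k \<le> p" "\<And>j. 1 \<le> j \<Longrightarrow> j < k \<Longrightarrow> \<not> [u ^ j = \<mu>] (mod p)"
  shows "cong_lam k A 1"
  using assms(4,5,6)
proof (induction k rule: dec_induct)
  case base
  show ?case by (rule assms(3))
next
  case (step k)
  thus ?case by (intro sigma_eigen_step[OF assms(1,2)]) auto
qed

section \<open>Powers of the primitive root and eigenvectors of \<sigma>\<close>

lemma u_pow_cong_iff: "[u ^ i = u ^ j] (mod p) \<longleftrightarrow> [i = j] (mod (p - 1))"
  using order_divides_expdiff[of p u i j] primroot totient_prime[OF prime_p]
  by (simp add: residue_primroot_def)

lemma exists_u_pow:
  assumes "0 < k" "k < p"
  shows "\<exists>s. [u ^ s = k] (mod p)"
proof -
  have "k \<in> totatives p"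
    using assms prime_p by (auto simp: totatives_def coprime_commute prime_nat_iff'' intro!: prime_imp_coprime dest: dvd_imp_le)
  with residue_primroot_is_generator[of p u] primroot p_ge_3
  have "k \<in> (\<lambda>i. u ^ i mod p) ` {..<totient p}" by (auto simp: bij_betw_def)
  thus ?thesis using assms by (auto simp: cong_def)
qed

text \<open>The sum of the theorem (for \<open>k = 1\<close>) times \<open>\<mu>\<^sup>p\<^sup>-\<^sup>2\<close>, which makes it integral.\<close>

definition eigen_sum :: "nat \<Rightarrow> nat \<Rightarrow> complex" where
  "eigen_sum \<mu> k = (\<Sum>i=0..p-2. of_nat \<mu> ^ (p - 2 - i) * \<zeta> ^ (k * u ^ i))"

lemma eigen_sum_OK [intro, simp]: "eigen_sum \<mu> k \<in> OK"
  unfolding eigen_sum_def by auto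

lemma zeta_pow_cong: "[m = n] (mod p) \<Longrightarrow> \<zeta> ^ m = \<zeta> ^ n"
  by (metis cong_def zeta_pow_mod)

lemma eigen_sum_cong: "[k = l] (mod p) \<Longrightarrow> eigen_sum \<mu> k = eigen_sum \<mu> l"
  unfolding eigen_sum_def by (intro sum.cong refl arg_cong2[of _ _ _ _ "(*)"] zeta_pow_cong cong_mult cong_refl)

text \<open>Replacing \<zeta> by \<open>\<zeta> ^ u\<close> shifts the summation index, so the
  difference is that of the boundary terms \<open>\<zeta> ^ k\<close> and
  \<open>\<mu> ^ (p - 1) * \<zeta> ^ k\<close>. Fermat makes them congruent.\<close>

lemma eigen_sum_shift:
  assumes "\<not> p dvd \<mu>"
  shows "cong_lam (p - 1) (eigen_sum \<mu> (k * u)) (of_nat \<mu> * eigen_sum \<mu> k)"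
proof -
  define f where "f i = of_nat \<mu> ^ (p - 1 - i) * \<zeta> ^ (k * u ^ i)" for i
  have p1: "p - 1 = Suc (p - 2)" using p_ge_3 by simp
  have "eigen_sum \<mu> (k * u) = (\<Sum>i=0..p-2. f (Suc i))"
    unfolding eigen_sum_def f_def by (simp add: mult.assoc p1)
  moreover have "of_nat \<mu> * eigen_sum \<mu> k = (\<Sum>i=0..p-2. f i)"
    unfolding eigen_sum_def f_def sum_distrib_left
  proof (intro sum.cong refl)
    fix i assume "i \<in> {0..p-2}"
    hence "p - 1 - i = Suc (p - 2 - i)" using p_ge_3 by auto
    thus "of_nat \<mu> * (of_nat \<mu> ^ (p - 2 - i) * \<zeta> ^ (k * u ^ i)) = of_nat \<mu> ^ (p - 1 - i) * \<zeta> ^ (k * u ^ i)"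
      by (simp only: power_Suc mult.assoc)
  qed
  moreover have "(\<Sum>i=0..p-2. f (Suc i)) + f 0 = (\<Sum>i=0..p-2. f i) + f (Suc (p - 2))"
    using sum.atLeast0_atMost_Suc_shift[of f "p - 2"] sum.atLeast0_atMost_Suc[of f "p - 2"] by simp
  ultimately have "eigen_sum \<mu> (k * u) - of_nat \<mu> * eigen_sum \<mu> k = f (Suc (p - 2)) - f 0"
    by (simp add: algebra_simps)
  also have "f (Suc (p - 2)) = \<zeta> ^ k"
  proof -
    have "[u ^ (p - 1) = 1] (mod p)"
      using u_pow_cong_iff[of "p - 1" 0] by (simp add: cong_def)
    hence "\<zeta> ^ (k * u ^ (p - 1)) = \<zeta> ^ (k * 1)" by (intro zeta_pow_cong cong_mult cong_refl)
    thus ?thesis by (simp add: f_def flip: p1)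
  qed
  also have "\<zeta> ^ k - f 0 = (of_int 1 - of_int (int (\<mu> ^ (p - 1)))) * \<zeta> ^ k"
    by (simp add: f_def algebra_simps)
  finally have eq: "eigen_sum \<mu> (k * u) - of_nat \<mu> * eigen_sum \<mu> k = (of_int 1 - of_int (int (\<mu> ^ (p - 1)))) * \<zeta> ^ k" .
  have "[1 = \<mu> ^ (p - 1)] (mod p)" using fermat_theorem[OF prime_p assms] by (rule cong_sym)
  hence "cong_lam (p - 1) (of_int 1) (of_int (int (\<mu> ^ (p - 1))))"
    by (intro cong_lam_of_int) (metis cong_int_iff of_nat_1)
  hence "cong_lam (p - 1) (of_int 1 - of_int (int (\<mu> ^ (p - 1)))) 0" by (subst (asm) cong_lam_iff_diff)
  from cong_lam_mult_left[OF this, of "\<zeta> ^ k"]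
  have "cong_lam (p - 1) ((of_int 1 - of_int (int (\<mu> ^ (p - 1)))) * \<zeta> ^ k) 0" by (simp add: mult.commute)
  thus ?thesis unfolding eq[symmetric] by (subst cong_lam_iff_diff)
qed

text \<open>A nonzero \<open>k\<close> is a power of \<open>u\<close> modulo \<open>p\<close>, so it
  is reached from 1 by repeated shifts. For \<open>k = 0\<close> the shift fixes the sum, hence
  \<open>1 - \<mu>\<close> kills it, and \<open>1 - \<mu>\<close> is a \<pi>-unit.\<close>

lemma eigen_sum_multiple:
  assumes "\<not> p dvd \<mu>" "\<not> [\<mu> = 1] (mod p)" "k < p"
  shows "\<exists>e::int. cong_lam (p - 1) (eigen_sum \<mu> k) (of_int e * eigen_sum \<mu> 1)"
proof (cases "k = 0")
  case True
  from eigen_sum_shift[OF assms(1), of 0]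
  have "cong_lam (p - 1) (eigen_sum \<mu> 0 - of_nat \<mu> * eigen_sum \<mu> 0) 0"
    by (subst (asm) cong_lam_iff_diff) simp
  hence "cong_lam (p - 1) (eigen_sum \<mu> 0 * (1 - of_nat \<mu>)) 0" by (simp add: algebra_simps)
  moreover have "\<not> cong_lam 1 (1 - of_nat \<mu>) 0"
    using assms(2) cong_lam_one_nat_iff[of 1 \<mu>] cong_lam_iff_diff[of 1 1 "of_nat \<mu>"] by (auto dest: cong_sym)
  ultimately have "cong_lam (p - 1) (eigen_sum \<mu> 0) 0" by (rule cong_lam_cancel) auto
  thus ?thesis using True by (intro exI[of _ 0]) simp
next
  case False
  then obtain s where s: "[u ^ s = k] (mod p)" using exists_u_pow assms(3) by blast
  have "cong_lam (p - 1) (eigen_sum \<mu> (u ^ s)) (of_nat (\<mu> ^ s) * eigen_sum \<mu> 1)"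
  proof (induction s)
    case 0
    show ?case by simp
  next
    case (Suc s)
    have "cong_lam (p - 1) (eigen_sum \<mu> (u ^ Suc s)) (of_nat \<mu> * eigen_sum \<mu> (u ^ s))"
      using eigen_sum_shift[OF assms(1), of "u ^ s"] by (simp add: mult.commute)
    also have "cong_lam (p - 1) \<dots> (of_nat \<mu> * (of_nat (\<mu> ^ s) * eigen_sum \<mu> 1))"
      by (intro cong_lam_mult_left Suc) auto
    finally show ?case by (simp add: mult.assoc)
  qed
  with eigen_sum_cong[OF s] show ?thesis by (intro exI[of _ "int (\<mu> ^ s)"]) simp
qed

text \<open>The sum of \<open>\<mu> ^ (p - 2 - i) * (\<sigma> ^^ i) D\<close> is evaluated twice:
  the eigenvalue relation gives \<open>(p - 1) * \<mu> ^ (p - 2) * D\<close>, while the coordinates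
  of \<open>D\<close> give a combination of the \<open>eigen_sum \<mu> k\<close>.\<close>

lemma eigenvector_multiple:
  assumes "\<not> p dvd \<mu>" "\<not> [\<mu> = 1] (mod p)" "D \<in> OK" "cong_lam (p - 1) (\<sigma> D) (of_nat \<mu> * D)"
  shows "\<exists>e::int. cong_lam (p - 1) (of_nat (\<mu> ^ (p - 2)) * D) (of_int e * eigen_sum \<mu> 1)"
proof -
  obtain c :: "nat \<Rightarrow> int" where c: "D = (\<Sum>k<p. of_int (c k) * \<zeta> ^ k)" using OK_as_sum[OF assms(3)] by blast
  obtain e :: "nat \<Rightarrow> int"
    where e: "\<And>k. k < p \<Longrightarrow> cong_lam (p - 1) (eigen_sum \<mu> k) (of_int (e k) * eigen_sum \<mu> 1)"
    using eigen_sum_multiple[OF assms(1,2)] by metis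
  have iter: "cong_lam (p - 1) ((\<sigma> ^^ i) D) (of_nat (\<mu> ^ i) * D)" for i
  proof (induction i)
    case 0
    show ?case by simp
  next
    case (Suc i)
    have "cong_lam (p - 1) (\<sigma> ((\<sigma> ^^ i) D)) (\<sigma> (of_nat (\<mu> ^ i) * D))"
      using assms(3) by (intro sigma_cong Suc) auto
    also have "\<sigma> (of_nat (\<mu> ^ i) * D) = of_nat (\<mu> ^ i) * \<sigma> D"
      using assms(3) by (subst sigma_mult) (auto simp del: of_nat_power)
    also have "cong_lam (p - 1) \<dots> (of_nat (\<mu> ^ i) * (of_nat \<mu> * D))"
      by (intro cong_lam_mult_left assms(4)) auto
    finally show ?case by (simp add: mult_ac)
  qed
  have "cong_lam (p - 1) (\<Sum>i=0..p-2. of_nat \<mu> ^ (p - 2 - i) * (\<sigma> ^^ i) D)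
          (\<Sum>i=0..p-2. of_nat \<mu> ^ (p - 2 - i) * (of_nat (\<mu> ^ i) * D))"
    by (intro cong_lam_sum cong_lam_mult_left iter) auto
  also have "(\<Sum>i=0..p-2. of_nat \<mu> ^ (p - 2 - i) * (of_nat (\<mu> ^ i) * D))
      = (\<Sum>i=0..p-2. of_nat (\<mu> ^ (p - 2)) * D)"
  proof (intro sum.cong refl)
    fix i assume "i \<in> {0..p-2}"
    hence "p - 2 - i + i = p - 2" by simp
    hence "\<mu> ^ (p - 2) = \<mu> ^ (p - 2 - i) * \<mu> ^ i" by (metis power_add)
    thus "of_nat \<mu> ^ (p - 2 - i) * (of_nat (\<mu> ^ i) * D) = of_nat (\<mu> ^ (p - 2)) * D" by simp
  qed
  \<comment> \<open>There are \<open>p - 1\<close> equal terms; modulo \<open>lam ^ (p - 1)\<close>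
    this factor acts as \<open>-1\<close>, which is the source of the sign in the witness.\<close>
  also have "\<dots> = of_nat p * (of_nat (\<mu> ^ (p - 2)) * D) - of_nat (\<mu> ^ (p - 2)) * D"
    using p_ge_3 by (simp add: of_nat_diff algebra_simps)
  finally have 1: "cong_lam (p - 1) (\<Sum>i=0..p-2. of_nat \<mu> ^ (p - 2 - i) * (\<sigma> ^^ i) D)
      (of_nat p * (of_nat (\<mu> ^ (p - 2)) * D) - of_nat (\<mu> ^ (p - 2)) * D)" .
  have 2: "cong_lam (p - 1) (of_nat p * (of_nat (\<mu> ^ (p - 2)) * D)) 0"
    using assms(3) by (intro cong_lam_p_multiple) auto
  have "(\<Sum>i=0..p-2. of_nat \<mu> ^ (p - 2 - i) * (\<sigma> ^^ i) D)
      = (\<Sum>i=0..p-2. \<Sum>k<p. of_int (c k) * (of_nat \<mu> ^ (p - 2 - i) * \<zeta> ^ (k * u ^ i)))"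
    unfolding c sigma_iter_zeta_sum sum_distrib_left by (simp add: mult.left_commute)
  also have "\<dots> = (\<Sum>k<p. of_int (c k) * eigen_sum \<mu> k)"
    unfolding eigen_sum_def sum_distrib_left by (rule sum.swap)
  also have "cong_lam (p - 1) \<dots> (\<Sum>k<p. of_int (c k) * (of_int (e k) * eigen_sum \<mu> 1))"
    by (intro cong_lam_sum cong_lam_mult_left e) auto
  also have "(\<Sum>k<p. of_int (c k) * (of_int (e k) * eigen_sum \<mu> 1)) = of_int (\<Sum>k<p. c k * e k) * eigen_sum \<mu> 1"
    by (simp add: sum_distrib_right mult.assoc)
  finally have 3: "cong_lam (p - 1) (\<Sum>i=0..p-2. of_nat \<mu> ^ (p - 2 - i) * (\<sigma> ^^ i) D)
      (of_int (\<Sum>k<p. c k * e k) * eigen_sum \<mu> 1)" .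
  from cong_lam_diff[OF 2 cong_lam_trans[OF cong_lam_sym[OF 1] 3]]
  show ?thesis by (intro exI[of _ "- (\<Sum>k<p. c k * e k)"]) simp
qed

end

theorem theorem2p8:
  fixes p u m \<mu> :: nat and \<zeta> B \<alpha> :: complex and \<sigma> :: "complex \<Rightarrow> complex"
    and \<bb> :: "complex set"
  assumes "Factorial_Ring.prime p" and "odd p"
    and "primitive_root_of_unity p \<zeta>"
    and "residue_primroot p u"
    and "\<sigma> \<in> Gal_rat (cyc_field \<zeta>)" and "\<sigma> \<zeta> = \<zeta> ^ u"
    and "1 \<le> m" and "real m \<le> (real p - 3) / 2"
    and "\<mu> = u ^ (2 * m) mod p"
    and "ideal \<bb> (cyc_ints \<zeta>)"
    and "cyc_class \<zeta> \<bb> \<in> class_group_p_plus p \<zeta>"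
    and "group.ord (cyc_class_group \<zeta>) (cyc_class \<zeta> \<bb>) = p"
    and "annihilated_by \<zeta> \<sigma> \<mu> (cyc_class \<zeta> \<bb>)"
    and "singular_integer p \<zeta> B" and "semi_primary p \<zeta> B"
    and "B <#\<^bsub>cyc_ints \<zeta>\<^esub> carrier (cyc_ints \<zeta>) = \<bb> [^]\<^bsub>ideals_set (cyc_ints \<zeta>)\<^esub> p"
    and "\<alpha> \<in> carrier (cyc_field \<zeta>)" and "\<sigma> B = B ^ \<mu> * \<alpha> ^ p"
    and "real m > (real p - 1) / 4"
  shows "\<exists>\<delta>::int.
    pi_cong \<zeta> (p - 1) (B ^ (p - 1))
      (1 - of_int \<delta> * (\<Sum>i=0..p-2. inverse (of_nat \<mu> ^ i) * \<zeta> ^ (u ^ i mod p))) \<and>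
    (\<not> primary p \<zeta> B \<longrightarrow> coprime \<delta> (int p))"
proof -
  interpret prime_cyclotomic_galois p \<zeta> u \<sigma>
    using assms by unfold_locales
  \<comment> \<open>Integer forms of the bounds: \<open>2 * m\<close> stays below
    \<open>p - 1\<close>, and \<open>4 * m \<ge> p\<close> makes the quadratic error vanish modulo
    \<open>lam ^ (p - 1)\<close>.\<close>
  have "real (2 * m + 3) \<le> real p" using assms(8) by simp
  moreover have "real p < real (4 * m + 1)" using assms(19) by simp
  ultimately have m: "2 * m + 3 \<le> p" "p \<le> 4 * m" unfolding of_nat_le_iff of_nat_less_iff by simp_all
  have \<mu>: "[u ^ j = \<mu>] (mod p) \<longleftrightarrow> [j = 2 * m] (mod (p - 1))" for j
    using u_pow_cong_iff[of j "2 * m"] by (simp add: assms(9))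
  have \<mu>_unit: "\<not> p dvd \<mu>"
  proof -
    have "coprime p u" using assms(4) by (simp add: residue_primroot_def)
    hence "\<not> p dvd u ^ (2 * m)"
      using prime_p by (metis coprime_absorb_left not_prime_unit prime_dvd_power)
    thus ?thesis by (simp add: assms(9) dvd_mod_iff)
  qed
  have \<mu>_neq_1: "\<not> [\<mu> = 1] (mod p)"
    using \<mu>[of 0] m assms(7) by (auto simp: cong_def)
  \<comment> \<open>The range includes \<open>p - 1\<close>, which is 0 modulo \<open>p - 1\<close>
    and so differs from \<open>2 * m\<close>. That case allows the last step from
    \<open>lam ^ (p - 1)\<close> to \<open>lam ^ p\<close>.\<close>
  have exps: "\<not> [u ^ j = \<mu>] (mod p)" if "1 \<le> j" "j \<le> p - 1" "j \<noteq> 2 * m" for j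
    using that m assms(7) unfolding \<mu> by (cases "j = p - 1") (auto simp: cong_def)
  have B: "B \<in> OK" using assms(14) by (simp add: singular_integer_def)
  obtain c :: int where c: "\<not> [c = 0] (mod int p)" "cong_lam 2 B (of_int c)"
    using assms(15) B by (auto simp: semi_primary_def pi_cong_OK_iff)
  have cB: "cong_lam 1 B (of_int c)" using c(2) by (rule cong_lam_mono) simp
  \<comment> \<open>Stated for every \<open>x\<close>, to cover both \<open>B\<close> and
    \<open>\<sigma> B\<close>, which is congruent to \<open>c\<close> since \<sigma> fixes
    integers.\<close>
  have unit: "\<not> cong_lam 1 x 0" if "cong_lam 1 x (of_int c)" for x
    using that c(1) cong_lam_one_int_iff[of c 0] cong_lam_trans[of 1 "of_int c" x 0] cong_lam_sym[of 1 x "of_int c"] by auto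
  define A where "A = B ^ (p - 1)"
  have A: "A \<in> OK" "cong_lam 1 A 1"
    using B cong_lam_fermat[OF B unit[OF cB]] by (auto simp: A_def)
  have "cong_lam p (\<sigma> B ^ (p - 1)) ((B ^ \<mu>) ^ (p - 1))"
    using sigma_cong[OF cB B] lam_prime_power[of B \<mu>] unit[of B] unit[of "\<sigma> B"] B cB
    by (intro cong_lam_of_pth_power_ratio[OF assms(17) _ _ _ _ assms(18)]) auto
  hence eigen: "cong_lam p (\<sigma> A) (A ^ \<mu>)"
    using B by (simp add: A_def sigma_power mult.commute flip: power_mult)
  have "cong_lam (2 * m) A 1"
    using m assms(7) by (intro sigma_eigen_cong[OF A(1) eigen A(2)] exps) auto
  hence "cong_lam (2 * (2 * m)) (A ^ \<mu>) (1 + of_nat \<mu> * (A - 1))"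
    by (rule cong_lam_power_linear[OF A(1)])
  hence "cong_lam (p - 1) (A ^ \<mu>) (1 + of_nat \<mu> * (A - 1))"
    using m by (elim cong_lam_mono) simp
  moreover have "cong_lam (p - 1) (\<sigma> A) (A ^ \<mu>)"
    by (rule cong_lam_mono[OF eigen]) simp
  ultimately have "cong_lam (p - 1) (\<sigma> A - 1) (1 + of_nat \<mu> * (A - 1) - 1)"
    by (intro cong_lam_diff cong_lam_refl) (rule cong_lam_trans)
  hence "cong_lam (p - 1) (\<sigma> (A - 1)) (of_nat \<mu> * (A - 1))"
    using A(1) by (simp add: sigma_diff)
  from eigenvector_multiple[OF \<mu>_unit \<mu>_neq_1 _ this]
  obtain e :: int where e: "cong_lam (p - 1) (of_nat (\<mu> ^ (p - 2)) * (A - 1)) (of_int e * eigen_sum \<mu> 1)"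
    using A(1) by auto
  \<comment> \<open>\<open>M\<close> is the \<pi>-unit that clears the denominators of
    \<open>S\<close>: \<open>eigen_sum \<mu> 1 = M * S\<close>.\<close>
  define M :: complex where "M = of_nat (\<mu> ^ (p - 2))"
  define S where "S = (\<Sum>i=0..p-2. inverse (of_nat \<mu> ^ i) * \<zeta> ^ (u ^ i mod p))"
  have "\<not> p dvd \<mu> ^ (p - 2)" using \<mu>_unit prime_dvd_power[OF prime_p] by blast
  hence M1: "\<not> cong_lam 1 M 0" unfolding M_def cong_lam_one_nat_0 .
  hence "M \<noteq> 0" using cong_lam_refl[of 1 0] by metis
  with M1 have M: "M \<in> OK" "\<not> cong_lam 1 M 0" "M \<noteq> 0" by (simp_all add: M_def)
  have \<mu>0: "\<mu> \<noteq> 0" using \<mu>_unit by (cases "\<mu> = 0") auto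
  have S: "S = eigen_sum \<mu> 1 / M"
    unfolding S_def eigen_sum_def M_def sum_divide_distrib
  proof (intro sum.cong refl)
    fix i assume "i \<in> {0..p-2}"
    hence "p - 2 - i + i = p - 2" by simp
    hence "of_nat (\<mu> ^ (p - 2)) = of_nat \<mu> ^ (p - 2 - i) * (of_nat \<mu> ^ i :: complex)"
      by (metis power_add of_nat_power)
    thus "inverse (of_nat \<mu> ^ i) * \<zeta> ^ (u ^ i mod p)
        = of_nat \<mu> ^ (p - 2 - i) * \<zeta> ^ (1 * u ^ i) / of_nat (\<mu> ^ (p - 2))"
      using \<mu>0 by (simp add: zeta_pow_mod divide_simps)
  qed
  \<comment> \<open>As \<open>A - 1\<close> is congruent to \<open>e * S\<close>, the witness for
    \<delta> is \<open>- e\<close>.\<close>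
  have "A - (1 - of_int (- e) * S) = (M * (A - 1) - of_int e * eigen_sum \<mu> 1) / M"
    using M(3) by (simp add: S field_simps)
  moreover have "cong_lam (p - 1) (M * (A - 1) - of_int e * eigen_sum \<mu> 1) 0"
    using e unfolding M_def by (subst (asm) cong_lam_iff_diff)
  ultimately have diff: "A - (1 - of_int (- e) * S) \<in> pi_local \<zeta> (p - 1)"
    using pi_localI[OF _ M(1,2)] by metis
  have "1 - of_int (- e) * S = (M + of_int e * eigen_sum \<mu> 1) / M"
    using M(3) by (simp add: S field_simps)
  moreover have "(M + of_int e * eigen_sum \<mu> 1) / M \<in> pi_local \<zeta> 0"
    using M by (intro pi_localI) auto
  ultimately have int: "1 - of_int (- e) * S \<in> pi_local \<zeta> 0" by simp
  have "A \<in> pi_local \<zeta> 0"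
    using pi_cong_OK_iff[OF A(1) A(1), of 0] by (simp add: pi_cong_def)
  with int diff have "pi_cong \<zeta> (p - 1) A (1 - of_int (- e) * S)"
    by (simp add: pi_cong_def)
  moreover have "coprime (- e) (int p)" if "\<not> primary p \<zeta> B"
  proof (rule ccontr)
    assume "\<not> coprime (- e) (int p)"
    hence "int p dvd e" using prime_p by (metis coprime_commute coprime_minus_left_iff prime_imp_coprime prime_nat_int_transfer)
    \<comment> \<open>\<open>p\<close> is itself a multiple of \<open>lam ^ (p - 1)\<close>;
      cancelling the \<pi>-unit \<open>M\<close> then leaves \<open>A\<close> congruent to
      1.\<close>
    hence "cong_lam (p - 1) (of_int e * eigen_sum \<mu> 1) 0"
      using cong_lam_p_multiple by (auto elim!: dvdE simp: mult.assoc)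
    with e have "cong_lam (p - 1) (M * (A - 1)) 0" unfolding M_def by (rule cong_lam_trans)
    hence "cong_lam (p - 1) (A - 1) 0"
      using M A by (intro cong_lam_cancel[of _ "A - 1" M]) (auto simp: mult.commute)
    hence "cong_lam (p - 1) A 1" by (subst cong_lam_iff_diff)
    hence "cong_lam (Suc (p - 1)) A 1"
      using m by (intro sigma_eigen_step[OF A(1) eigen] exps) auto
    hence "cong_lam p 1 A" using p_ge_3 by (auto intro: cong_lam_sym)
    \<comment> \<open>Here \<open>B * A = B ^ p\<close>, and the residue \<open>c\<close> of
      \<open>B\<close> modulo \<open>lam\<close> determines \<open>B ^ p\<close> modulo
      \<open>lam ^ p\<close>.\<close>
    from cong_lam_mult_left[OF this B] have "cong_lam p B (B ^ p)"
      using p_ge_3 by (simp add: A_def flip: power_Suc)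
    also have "cong_lam p (B ^ p) (of_int c ^ p)"
      using cB B by (intro cong_lam_pow_p) auto
    finally have "pi_cong \<zeta> p B (of_int c ^ p)" using B by (subst pi_cong_OK_iff) auto
    with c(1) assms(14) have "primary p \<zeta> B" by (auto simp: primary_def singular_integer_def)
    with that show False by blast
  qed
  ultimately show ?thesis unfolding A_def S_def by blast
qed

end
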